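(* Let $n\ge 1$ be an integer, let $\{a_{i,j}\}_{1\le i,j\le n}$ be a collection of non-negative real numbers, and let $\Pi_n$ be a uniformly distributed random permutation of $\{1,\dots,n\}$. Consider $Z_n=\sum_{i=1}^n a_{i,\Pi_n(i)}$. Then, for all $x>0$, $$\mathbb{P}\left(\left|Z_n-\operatorname{med}(Z_n)\right|\ >\ \sqrt{\operatorname{med}\left(\sum_{i=1}^n a_{i,\Pi_n(i)}^2\right)x}+x\max_{1\le i,j\le n}\{a_{i,j}\}\right)\ \le\ 8\exp\left(\frac{-x}{16}\right).$$
   Context: A uniformly distributed random permutation of $\{1,\dots,n\}$ takes each of the $n!$ permutations with probability $1/n!$. For a real random variable $X$, $\operatorname{med}(X)$ denotes a median of $X$, i.e. a real number satisfying $\mathbb{P}(X\ge \operatorname{med}(X))\ge 1/2$ and $\mathbb{P}(X\le \operatorname{med}(X))\ge 1/2$. *)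

theory Defs
  imports "HOL-Probability.Probability" "HOL-Combinatorics.Permutations"
begin

definition is_median :: "'w measure \<Rightarrow> ('w \<Rightarrow> real) \<Rightarrow> real \<Rightarrow> bool" where
  "is_median M X m \<longleftrightarrow>
     measure M {\<omega> \<in> space M. X \<omega> \<ge> m} \<ge> 1 / 2 \<and>
     measure M {\<omega> \<in> space M. X \<omega> \<le> m} \<ge> 1 / 2"

definition uniform_random_permutation ::
    "'w measure \<Rightarrow> nat \<Rightarrow> ('w \<Rightarrow> nat \<Rightarrow> nat) \<Rightarrow> bool" where
  "uniform_random_permutation M n \<sigma> \<longleftrightarrow>
     \<sigma> \<in> measurable M (count_space {\<pi>. \<pi> permutes {1..n}}) \<and>
     distr M (count_space {\<pi>. \<pi> permutes {1..n}}) \<sigma> =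
       uniform_count_measure {\<pi>. \<pi> permutes {1..n}}"

end

theory Submission
  imports Defs
begin

text \<open>
  Identify a permutation with its set of edges \<open>(i, \<pi> i)\<close> in the complete bipartite graph. For a set
  \<open>A\<close> of permutations, the squared convex distance of \<open>\<pi>\<close> to \<open>A\<close> is the minimum, over all probability
  weights \<open>p\<close> on \<open>A\<close>, of \<open>\<Sum>e\<in>\<pi>. (p {\<tau>. e \<notin> \<tau>})\<^sup>2\<close>. Talagrand's inequality for the symmetric group says
  that the average of \<open>exp (squared distance / 16)\<close> is at most the inverse of the density of \<open>A\<close>.
  It is proved here by induction over the size of the graph
  (\<open>talagrand_bound_step\<close>, \<open>talagrand_bound_double_row\<close>).

  The induction slices the permutations according to the partner \<open>i\<close> of one fixed row \<open>r\<close> and compares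
  every slice with the largest one, \<open>j\<close>. A permutation of slice \<open>i\<close> is moved into slice \<open>j\<close> by exchanging
  the columns \<open>i\<close> and \<open>j\<close>, which changes two edges: the one at row \<open>r\<close>, and a second one, in column \<open>j\<close>,
  at a row that depends on the permutation. If the mixture puts mass \<open>1 - l\<close> on slice \<open>j\<close>, then the first
  edge costs \<open>(1 - l)\<^sup>2\<close>, but the second one costs \<open>(l u + (1 - l))\<^sup>2\<close> with a cross term that is only linear
  in \<open>1 - l\<close>. The remedy is to prove a stronger inequality in which the edge at one chosen vertex counts
  twice: by \<open>(l u + (1 - l))\<^sup>2 \<le> 2 l u\<^sup>2 + 2 (1 - l)\<^sup>2\<close> the cross term is absorbed by the doubled weight that
  the induction hypothesis allows at column \<open>j\<close>. Doubling at row \<open>r\<close> then gives the total error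
  \<open>4 (1 - l)\<^sup>2\<close>, which explains the constant 16. Transposition of the graph turns a doubled column into
  a doubled row, so that the induction closes (\<open>hull_close_two_slices\<close>, \<open>talagrand_bound_converse\<close>).

  The median bound uses only the following consequence (\<open>permutation_statistics_separation\<close>). Let
  \<open>Z\<close> be the permuted sum of a nonnegative array and \<open>V\<close> the permuted sum of its squares. If \<open>Z \<pi> - Z \<tau>\<close>
  exceeds \<open>sqrt (x * V \<pi>)\<close> for all \<open>\<pi> \<in> B\<close> and \<open>\<tau> \<in> A\<close>, then the probabilities of \<open>A\<close> and \<open>B\<close> have a product of at
  most \<open>q = exp (- x / 16)\<close>. Nonnegativity matters here: only the edges of \<open>\<pi>\<close> missing from \<open>\<tau>\<close> contribute positively to
  \<open>Z \<pi> - Z \<tau>\<close>, so that the normalisation involves \<open>V \<pi>\<close> alone. It is applied three times, with \<open>K\<close> the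
  largest entry of the array.

  \<^item> For the array of squares and the sets \<open>V \<le> v\<close> and \<open>sqrt V > sqrt v + K * sqrt x\<close> it shows that the
    second one has probability at most \<open>2 q\<close>. Outside of it, \<open>sqrt (x * V)\<close> is at most the deviation
    \<open>D = sqrt (v * x) + x * K\<close> of the theorem.
  \<^item> For the sets \<open>Z \<le> m\<close> and \<open>Z > m + sqrt (x * V)\<close> it bounds the upper tail by \<open>2 q + 2 q\<close>.
  \<^item> For the sets \<open>Z < m - D\<close> and \<open>Z \<ge> m\<close>, the latter without the exceptional set above, it bounds the
    lower tail by \<open>q / (1 / 2 - 2 q)\<close>. This is at most \<open>4 q\<close> as soon as \<open>q < 1 / 8\<close>, and for larger \<open>q\<close> the
    claim is trivial.
\<close>

section \<open>Two scalar inequalities\<close>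

text \<open>With \<open>r\<close> the ratio of a slice to the largest slice, the left-hand side is the loss of a mixture with
  parameter \<open>l\<close>. The unconstrained minimum is at \<open>l = 1 + 2 * ln r\<close>; when this is negative, the best choice
  is \<open>l = 0\<close>. The bound \<open>2 - r\<close> is linear in \<open>r\<close> and can therefore be summed over the slices.\<close>

lemma talagrand_scalar_inequality:
  fixes r :: real
  assumes "0 < r" "r \<le> 1"
  obtains l where "0 \<le> l" "l \<le> 1" "exp ((1 - l)\<^sup>2 / 4) * r powr (- l) \<le> 2 - r"
proof (cases "exp (- 1/2) \<le> r")
  case False
  have "exp (1/4 :: real) \<le> 1 + 1/4 + (1/4)\<^sup>2"
    by (rule exp_bound) auto
  moreover have "exp (1/2 :: real) \<ge> 1 + 1/2"
    by (rule exp_ge_add_one_self)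
  then have "exp (- 1/2 :: real) \<le> 2/3"
    by (simp add: exp_minus field_simps)
  ultimately show thesis
    using False assms by (intro that [of 0]) (auto simp: power2_eq_square)
next
  case True
  define L where "L = ln r"
  have L: "- 1/2 \<le> L" "L \<le> 0"
    using True assms by (auto simp: L_def ln_ge_iff)
  \<comment> \<open>The claim is \<open>g r \<ge> 0 = g 1\<close>, and the derivative of \<open>g\<close> has the sign of \<open>h\<close>.\<close>
  define h where "h = (\<lambda>s::real. (1 - s) + (2 - s) * ln s)"
  define g where "g = (\<lambda>s::real. ln (2 - s) + ln s + (ln s)\<^sup>2)"
  have h: "h s \<le> 0" if "0 < s" "s \<le> 1" for s
  proof -
    have "h s \<le> h 1"
    proof (rule DERIV_nonneg_imp_nondecreasing [OF \<open>s \<le> 1\<close>])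
      fix y assume y: "s \<le> y" "y \<le> 1"
      then have "0 < y" using that by simp
      have "(h has_real_derivative (- 1 - ln y + (2 - y) / y)) (at y)"
        unfolding h_def using \<open>0 < y\<close> by (auto intro!: derivative_eq_intros simp: field_simps)
      moreover have "0 \<le> - 1 - ln y + (2 - y) / y"
      proof -
        have "ln y \<le> 0" "(2 - y) / y \<ge> 1" using y \<open>0 < y\<close> by auto
        then show ?thesis by linarith
      qed
      ultimately show "\<exists>d. (h has_real_derivative d) (at y) \<and> 0 \<le> d" by blast
    qed
    then show ?thesis by (simp add: h_def)
  qed
  have "g 1 \<le> g r"
  proof (rule DERIV_nonpos_imp_nonincreasing [OF \<open>r \<le> 1\<close>])
    fix y assume y: "r \<le> y" "y \<le> 1"
    then have "0 < y" using assms by simp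
    have "(g has_real_derivative (- 1 / (2 - y) + 1 / y + 2 * ln y / y)) (at y)"
      unfolding g_def using \<open>0 < y\<close> y by (auto intro!: derivative_eq_intros simp: field_simps)
    moreover have "- 1 / (2 - y) + 1 / y + 2 * ln y / y = 2 * h y / (y * (2 - y))"
      unfolding h_def using \<open>0 < y\<close> y by (simp add: field_simps)
    moreover have "2 * h y / (y * (2 - y)) \<le> 0"
      using h [of y] \<open>0 < y\<close> y by (intro divide_nonpos_nonneg) auto
    ultimately show "\<exists>d. (g has_real_derivative d) (at y) \<and> d \<le> 0" by metis
  qed
  then have g: "- L - L\<^sup>2 \<le> ln (2 - r)"
    by (simp add: g_def L_def)
  have "exp ((1 - (1 + 2 * L))\<^sup>2 / 4) * r powr (- (1 + 2 * L)) = exp (- L - L\<^sup>2)"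
    using assms by (simp add: powr_def L_def [symmetric] exp_add [symmetric] power2_eq_square algebra_simps)
  also have "\<dots> \<le> 2 - r"
    using g assms by (simp add: ln_ge_iff)
  finally show thesis
    using L by (intro that [of "1 + 2 * L"]) auto
qed

text \<open>Hoelder's inequality with exponents \<open>1 / l\<close> and \<open>1 / (1 - l)\<close>. After normalising both sums to 1,
  it is the convexity of the exponential function.\<close>

lemma sum_exp_convex_combination_le:
  fixes f g :: "'a \<Rightarrow> real"
  assumes "finite S" "0 \<le> l" "l \<le> 1"
    and f: "(\<Sum>s\<in>S. exp (f s)) \<le> a" and g: "(\<Sum>s\<in>S. exp (g s)) \<le> b"
    and "0 < a" "0 < b"
  shows "(\<Sum>s\<in>S. exp (l * f s + (1 - l) * g s)) \<le> a powr l * b powr (1 - l)"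
proof -
  have *: "exp (l * f s + (1 - l) * g s) \<le>
      a powr l * b powr (1 - l) * (l * (exp (f s) / a) + (1 - l) * (exp (g s) / b))" for s
  proof -
    have "exp (l * f s + (1 - l) * g s)
        = a powr l * b powr (1 - l) * exp (l * (f s - ln a) + (1 - l) * (g s - ln b))"
      using assms by (simp add: powr_def exp_add [symmetric] algebra_simps)
    also have "exp (l * (f s - ln a) + (1 - l) * (g s - ln b))
        \<le> l * exp (f s - ln a) + (1 - l) * exp (g s - ln b)"
      using convex_onD [OF exp_convex, of "1 - l" "f s - ln a" "g s - ln b"] assms by simp
    also have "\<dots> = l * (exp (f s) / a) + (1 - l) * (exp (g s) / b)"
      using assms by (simp add: exp_diff)
    finally show ?thesis using assms by simp
  qed
  have "(\<Sum>s\<in>S. exp (l * f s + (1 - l) * g s)) \<le>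
      a powr l * b powr (1 - l) * (l * ((\<Sum>s\<in>S. exp (f s)) / a) + (1 - l) * ((\<Sum>s\<in>S. exp (g s)) / b))"
    using sum_mono [of S, OF *]
    by (simp add: sum_distrib_left sum.distrib sum_divide_distrib distrib_left)
  also have "\<dots> \<le> a powr l * b powr (1 - l) * (l * 1 + (1 - l) * 1)"
    using assms by (intro mult_left_mono add_mono mult_left_mono) auto
  finally show ?thesis by simp
qed

section \<open>Perfect matchings and their slices\<close>

text \<open>Perfect matchings of the complete bipartite graph on \<open>X\<close> and \<open>Y\<close>. Bijections are represented by their
  edge sets because this makes the two sides symmetric and makes fixing a value the removal of an edge.\<close>

definition matchings :: "'a set \<Rightarrow> 'b set \<Rightarrow> ('a \<times> 'b) set set" where
  "matchings X Y = {\<sigma>. \<sigma> \<subseteq> X \<times> Y \<and> (\<forall>x\<in>X. \<exists>!y. (x, y) \<in> \<sigma>) \<and> (\<forall>y\<in>Y. \<exists>!x. (x, y) \<in> \<sigma>)}"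

definition slice :: "'e set set \<Rightarrow> 'e \<Rightarrow> 'e set set" where
  "slice A e = {\<sigma>. e \<notin> \<sigma> \<and> insert e \<sigma> \<in> A}"

definition swap_columns :: "'b \<Rightarrow> 'b \<Rightarrow> ('a \<times> 'b) set \<Rightarrow> ('a \<times> 'b) set" where
  "swap_columns i j \<sigma> = map_prod id (Transposition.transpose i j) ` \<sigma>"

lemma finite_matchings: "finite X \<Longrightarrow> finite Y \<Longrightarrow> finite (matchings X Y)"
  by (rule finite_subset [of _ "Pow (X \<times> Y)"]) (auto simp: matchings_def)

lemma finite_matching: "finite X \<Longrightarrow> finite Y \<Longrightarrow> \<sigma> \<in> matchings X Y \<Longrightarrow> finite \<sigma>"
  by (rule finite_subset [of _ "X \<times> Y"]) (auto simp: matchings_def)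

lemma slice_matchings:
  assumes "r \<in> X" "i \<in> Y"
  shows "slice (matchings X Y) (r, i) = matchings (X - {r}) (Y - {i})"
proof (intro equalityI subsetI)
  fix \<sigma> assume "\<sigma> \<in> slice (matchings X Y) (r, i)"
  then have \<sigma>: "(r, i) \<notin> \<sigma>" "insert (r, i) \<sigma> \<in> matchings X Y"
    by (auto simp: slice_def)
  then have sub: "\<sigma> \<subseteq> X \<times> Y"
    and row: "\<And>x. x \<in> X \<Longrightarrow> \<exists>!y. (x, y) \<in> insert (r, i) \<sigma>"
    and col: "\<And>y. y \<in> Y \<Longrightarrow> \<exists>!x. (x, y) \<in> insert (r, i) \<sigma>"
    by (auto simp: matchings_def)
  have r: "(r, y) \<notin> \<sigma>" for y
    using row [OF assms(1)] \<sigma>(1) by blast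
  have i: "(x, i) \<notin> \<sigma>" for x
    using col [OF assms(2)] \<sigma>(1) by blast
  have "\<exists>!y. (x, y) \<in> \<sigma>" if "x \<in> X - {r}" for x
    using row [of x] that by auto
  moreover have "\<exists>!x. (x, y) \<in> \<sigma>" if "y \<in> Y - {i}" for y
    using col [of y] that by auto
  moreover have "\<sigma> \<subseteq> (X - {r}) \<times> (Y - {i})"
    using sub r i by auto
  ultimately show "\<sigma> \<in> matchings (X - {r}) (Y - {i})"
    by (simp add: matchings_def)
next
  fix \<sigma> assume "\<sigma> \<in> matchings (X - {r}) (Y - {i})"
  then have sub: "\<sigma> \<subseteq> (X - {r}) \<times> (Y - {i})"
    and row: "\<And>x. x \<in> X - {r} \<Longrightarrow> \<exists>!y. (x, y) \<in> \<sigma>"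
    and col: "\<And>y. y \<in> Y - {i} \<Longrightarrow> \<exists>!x. (x, y) \<in> \<sigma>"
    by (auto simp: matchings_def)
  have "\<exists>!y. (x, y) \<in> insert (r, i) \<sigma>" if "x \<in> X" for x
    using row [of x] that sub by (cases "x = r") auto
  moreover have "\<exists>!x. (x, y) \<in> insert (r, i) \<sigma>" if "y \<in> Y" for y
    using col [of y] that sub by (cases "y = i") auto
  ultimately show "\<sigma> \<in> slice (matchings X Y) (r, i)"
    using sub assms by (auto simp: slice_def matchings_def)
qed

lemma slice_mono: "A \<subseteq> B \<Longrightarrow> slice A e \<subseteq> slice B e"
  by (auto simp: slice_def)

lemma finite_slice:
  assumes "finite A"
  shows "finite (slice A e)"
proof (rule finite_subset)
  show "slice A e \<subseteq> (\<lambda>\<tau>. \<tau> - {e}) ` A"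
  proof
    fix \<sigma> assume "\<sigma> \<in> slice A e"
    then have "\<sigma> = insert e \<sigma> - {e}" "insert e \<sigma> \<in> A"
      by (auto simp: slice_def)
    then show "\<sigma> \<in> (\<lambda>\<tau>. \<tau> - {e}) ` A"
      by (rule image_eqI)
  qed
qed (simp add: assms)

lemma sum_slice:
  "(\<Sum>\<sigma>\<in>{\<sigma> \<in> slice A e. P (insert e \<sigma>)}. f (insert e \<sigma>)) = (\<Sum>\<tau>\<in>{\<tau> \<in> A. e \<in> \<tau> \<and> P \<tau>}. f \<tau>)"
  by (rule sum.reindex_bij_witness [of _ "\<lambda>\<tau>. \<tau> - {e}" "insert e"])
    (auto simp: slice_def insert_absorb)

lemma sum_matchings_by_slices:
  fixes f :: "_ \<Rightarrow> real"
  assumes "finite X" "finite Y" "r \<in> X" "A \<subseteq> matchings X Y"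
  shows "sum f A = (\<Sum>i\<in>Y. \<Sum>\<sigma>\<in>slice A (r, i). f (insert (r, i) \<sigma>))"
proof -
  have "finite A"
    using assms finite_matchings finite_subset by blast
  have "sum f A = (\<Sum>\<tau>\<in>A. \<Sum>i\<in>Y. if (r, i) \<in> \<tau> then f \<tau> else 0)"
  proof (rule sum.cong [OF refl])
    fix \<tau> assume "\<tau> \<in> A"
    then have "\<tau> \<in> matchings X Y" using assms by auto
    then have "\<tau> \<subseteq> X \<times> Y" "\<exists>!y. (r, y) \<in> \<tau>"
      using assms(3) by (auto simp: matchings_def)
    then obtain y where y: "y \<in> Y" "\<And>z. (r, z) \<in> \<tau> \<longleftrightarrow> z = y"
      by blast
    then have "(\<Sum>i\<in>Y. if (r, i) \<in> \<tau> then f \<tau> else 0) = (\<Sum>i\<in>Y. if i = y then f \<tau> else 0)"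
      by (intro sum.cong) auto
    then show "f \<tau> = (\<Sum>i\<in>Y. if (r, i) \<in> \<tau> then f \<tau> else 0)"
      using y assms by simp
  qed
  also have "\<dots> = (\<Sum>i\<in>Y. \<Sum>\<tau>\<in>A. if (r, i) \<in> \<tau> then f \<tau> else 0)"
    by (rule sum.swap)
  also have "\<dots> = (\<Sum>i\<in>Y. \<Sum>\<sigma>\<in>slice A (r, i). f (insert (r, i) \<sigma>))"
  proof (rule sum.cong [OF refl])
    fix i
    show "(\<Sum>\<tau>\<in>A. if (r, i) \<in> \<tau> then f \<tau> else 0) = (\<Sum>\<sigma>\<in>slice A (r, i). f (insert (r, i) \<sigma>))"
      using sum_slice [where e = "(r, i)" and P = "\<lambda>_. True" and f = f and A = A] \<open>finite A\<close>
      by (simp add: sum.inter_filter)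
  qed
  finally show ?thesis .
qed

lemma swap_columns_involution: "swap_columns i j (swap_columns i j \<sigma>) = \<sigma>"
  by (force simp: swap_columns_def image_image map_prod_def)

lemma swap_columns_commute: "swap_columns i j = swap_columns j i"
  by (simp add: swap_columns_def fun_eq_iff Transposition.transpose_commute)

lemma mem_swap_columns: "(x, y) \<in> swap_columns i j \<sigma> \<longleftrightarrow> (x, Transposition.transpose i j y) \<in> \<sigma>"
  by (force simp: swap_columns_def)

lemma swap_columns_matching:
  assumes "i \<in> Y" "j \<in> Y" "\<sigma> \<in> matchings X (Y - {i})"
  shows "swap_columns i j \<sigma> \<in> matchings X (Y - {j})"
proof -
  have sub: "\<sigma> \<subseteq> X \<times> (Y - {i})"
    and row: "\<And>x. x \<in> X \<Longrightarrow> \<exists>!y. (x, y) \<in> \<sigma>"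
    and col: "\<And>y. y \<in> Y - {i} \<Longrightarrow> \<exists>!x. (x, y) \<in> \<sigma>"
    using assms by (auto simp: matchings_def)
  have "Transposition.transpose i j y \<in> Y - {i}" if "y \<in> Y - {j}" for y
    using that assms by (auto simp: Transposition.transpose_def)
  then have "\<exists>!x. (x, y) \<in> swap_columns i j \<sigma>" if "y \<in> Y - {j}" for y
    using that col by (simp add: mem_swap_columns)
  moreover have "\<exists>!y. (x, y) \<in> swap_columns i j \<sigma>" if x: "x \<in> X" for x
  proof -
    obtain y where "\<And>z. (x, z) \<in> \<sigma> \<longleftrightarrow> z = y"
      using row [OF x] by blast
    then have "(x, z) \<in> swap_columns i j \<sigma> \<longleftrightarrow> z = Transposition.transpose i j y" for z
      by (metis mem_swap_columns transpose_involutory)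
    then show ?thesis
      by simp
  qed
  moreover have "swap_columns i j \<sigma> \<subseteq> X \<times> (Y - {j})"
  proof
    fix e assume "e \<in> swap_columns i j \<sigma>"
    moreover obtain x y where e: "e = (x, y)"
      by fastforce
    ultimately have "x \<in> X" "Transposition.transpose i j y \<in> Y - {i}"
      using sub by (auto simp: mem_swap_columns)
    then show "e \<in> X \<times> (Y - {j})"
      using assms e by (auto simp: Transposition.transpose_def split: if_splits)
  qed
  ultimately show ?thesis
    by (simp add: matchings_def)
qed

lemma bij_betw_swap_columns:
  assumes "i \<in> Y" "j \<in> Y"
  shows "bij_betw (swap_columns i j) (matchings X (Y - {i})) (matchings X (Y - {j}))"
  using swap_columns_matching [of i Y j] swap_columns_matching [of j Y i] assms
  by (intro bij_betw_byWitness [where f' = "swap_columns i j"])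
    (auto simp: swap_columns_involution swap_columns_commute [of j i])

text \<open>Exchanging the columns \<open>i\<close> and \<open>j\<close> in a matching that avoids column \<open>i\<close> affects a single edge, the one
  in column \<open>j\<close>. Its row \<open>k\<close> depends on the matching.\<close>

lemma swap_columns_decomposition:
  assumes "i \<in> Y" "j \<in> Y" "i \<noteq> j" "\<sigma> \<in> matchings X (Y - {i})"
  obtains k \<rho> where "\<sigma> = insert (k, j) \<rho>" "(k, j) \<notin> \<rho>"
    "swap_columns i j \<sigma> = insert (k, i) \<rho>" "(k, i) \<notin> \<rho>" "\<And>e. e \<in> \<rho> \<Longrightarrow> snd e \<noteq> j"
proof -
  have sub: "\<sigma> \<subseteq> X \<times> (Y - {i})" and col: "\<exists>!x. (x, j) \<in> \<sigma>"
    using assms by (auto simp: matchings_def)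
  then obtain k where k: "\<And>x. (x, j) \<in> \<sigma> \<longleftrightarrow> x = k"
    by blast
  define \<rho> where "\<rho> = \<sigma> - {(k, j)}"
  have *: "snd e \<noteq> i \<and> snd e \<noteq> j" if "e \<in> \<rho>" for e
    using that k sub by (cases e) (auto simp: \<rho>_def)
  have "swap_columns i j \<rho> = (\<lambda>e. e) ` \<rho>"
    unfolding swap_columns_def
    by (rule image_cong) (use * in \<open>auto simp: map_prod_def split_beta Transposition.transpose_def\<close>)
  then have "swap_columns i j \<rho> = \<rho>"
    by simp
  moreover have "\<sigma> = insert (k, j) \<rho>"
    using k by (auto simp: \<rho>_def)
  ultimately show thesis
    using * [of "(k, i)"] * [of "(k, j)"] *
    by (intro that [of k \<rho>]) (auto simp: swap_columns_def)
qed

lemma matching_converse: "\<sigma> \<in> matchings X Y \<Longrightarrow> \<sigma>\<inverse> \<in> matchings Y X"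
  by (auto simp: matchings_def)

lemma bij_betw_converse_matchings: "bij_betw converse (matchings X Y) (matchings Y X)"
  by (rule bij_betw_byWitness [where f' = converse]) (auto simp: matching_converse)

section \<open>Distance to the convex hull\<close>

text \<open>For probability weights \<open>p\<close> on \<open>A\<close>, the vector of all \<open>miss A p e\<close> with \<open>e\<close> in a matching \<open>\<sigma>\<close> is the general point of the convex hull of the
  indicator vectors that record, for each member of \<open>A\<close>, which edges of \<open>\<sigma>\<close> it lacks.\<close>

definition miss :: "'e set set \<Rightarrow> ('e set \<Rightarrow> real) \<Rightarrow> 'e \<Rightarrow> real" where
  "miss A p e = (\<Sum>\<tau>\<in>{\<tau> \<in> A. e \<notin> \<tau>}. p \<tau>)"

definition hull_cost :: "('e \<Rightarrow> real) \<Rightarrow> 'e set set \<Rightarrow> ('e set \<Rightarrow> real) \<Rightarrow> 'e set \<Rightarrow> real" where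
  "hull_cost w A p \<sigma> = (\<Sum>e\<in>\<sigma>. w e * (miss A p e)\<^sup>2)"

text \<open>The weighted squared convex distance of \<open>\<sigma>\<close> to \<open>A\<close> is at most \<open>t\<close>. Working with upper bounds avoids
  the question whether an optimal \<open>p\<close> exists.\<close>

definition hull_close :: "('e \<Rightarrow> real) \<Rightarrow> 'e set set \<Rightarrow> 'e set \<Rightarrow> real \<Rightarrow> bool" where
  "hull_close w A \<sigma> t \<longleftrightarrow> (\<exists>p. (\<forall>\<tau>. 0 \<le> p \<tau>) \<and> sum p A = 1 \<and> hull_cost w A p \<sigma> \<le> t)"

definition double_row :: "'a \<Rightarrow> 'a \<times> 'b \<Rightarrow> real" where
  "double_row r e = (if fst e = r then 2 else 1)"

definition double_column :: "'b \<Rightarrow> 'a \<times> 'b \<Rightarrow> real" where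
  "double_column c e = (if snd e = c then 2 else 1)"

definition lift_weights :: "'e \<Rightarrow> ('e set \<Rightarrow> real) \<Rightarrow> 'e set \<Rightarrow> real" where
  "lift_weights e p \<tau> = (if e \<in> \<tau> then p (\<tau> - {e}) else 0)"

lemma sum_lift_weights:
  assumes "finite A"
  shows "(\<Sum>\<tau>\<in>{\<tau> \<in> A. P \<tau>}. lift_weights e p \<tau>) = (\<Sum>\<sigma>\<in>{\<sigma> \<in> slice A e. P (insert e \<sigma>)}. p \<sigma>)"
proof -
  have "(\<Sum>\<tau>\<in>{\<tau> \<in> A. P \<tau>}. lift_weights e p \<tau>) = (\<Sum>\<tau>\<in>{\<tau> \<in> A. e \<in> \<tau> \<and> P \<tau>}. lift_weights e p \<tau>)"
    using assms by (intro sum.mono_neutral_right) (auto simp: lift_weights_def)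
  also have "\<dots> = (\<Sum>\<sigma>\<in>{\<sigma> \<in> slice A e. P (insert e \<sigma>)}. lift_weights e p (insert e \<sigma>))"
    by (rule sum_slice [symmetric])
  also have "\<dots> = (\<Sum>\<sigma>\<in>{\<sigma> \<in> slice A e. P (insert e \<sigma>)}. p \<sigma>)"
    by (rule sum.cong) (auto simp: lift_weights_def slice_def)
  finally show ?thesis .
qed

lemma sum_lift_weights_all: "finite A \<Longrightarrow> sum (lift_weights e p) A = sum p (slice A e)"
  using sum_lift_weights [where P = "\<lambda>_. True"] by simp

lemma miss_lift_weights:
  "finite A \<Longrightarrow> miss A (lift_weights e p) d = (if d = e then 0 else miss (slice A e) p d)"
  by (simp add: miss_def sum_lift_weights)

lemma miss_nonneg: "(\<And>\<tau>. 0 \<le> p \<tau>) \<Longrightarrow> 0 \<le> miss A p e"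
  by (simp add: miss_def sum_nonneg)

lemma miss_le_sum: "finite A \<Longrightarrow> (\<And>\<tau>. 0 \<le> p \<tau>) \<Longrightarrow> miss A p e \<le> sum p A"
  unfolding miss_def by (rule sum_mono2) auto

lemma miss_mix:
  "miss A (\<lambda>\<tau>. l * p \<tau> + (1 - l) * q \<tau>) e = l * miss A p e + (1 - l) * miss A q e"
  by (simp add: miss_def sum.distrib sum_distrib_left)

lemma convex_combination_square_le:
  fixes u w l :: real
  assumes "0 \<le> l" "l \<le> 1"
  shows "(l * u + (1 - l) * w)\<^sup>2 \<le> l * u\<^sup>2 + (1 - l) * w\<^sup>2"
proof -
  have "l * u\<^sup>2 + (1 - l) * w\<^sup>2 - (l * u + (1 - l) * w)\<^sup>2 = l * (1 - l) * (u - w)\<^sup>2"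
    by (simp add: power2_eq_square algebra_simps)
  moreover have "0 \<le> l * (1 - l) * (u - w)\<^sup>2"
    using assms by simp
  ultimately show ?thesis by linarith
qed

lemma hull_cost_mono:
  assumes "\<And>e. e \<in> \<sigma> \<Longrightarrow> w e \<le> w' e"
  shows "hull_cost w A p \<sigma> \<le> hull_cost w' A p \<sigma>"
  unfolding hull_cost_def using assms by (intro sum_mono mult_right_mono) auto

lemma hull_close_mono:
  assumes "hull_close w' A \<sigma> t" "\<And>e. e \<in> \<sigma> \<Longrightarrow> w e \<le> w' e"
  shows "hull_close w A \<sigma> t"
  using assms hull_cost_mono [of \<sigma> w w'] unfolding hull_close_def by (meson order_trans)

lemma hull_close_same_slice:
  assumes "finite A" "finite \<sigma>" "e \<notin> \<sigma>"
    and "hull_close w (slice A e) \<sigma> t"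
  shows "hull_close w A (insert e \<sigma>) t"
proof -
  obtain p where p: "\<And>\<tau>. 0 \<le> p \<tau>" "sum p (slice A e) = 1" "hull_cost w (slice A e) p \<sigma> \<le> t"
    using assms by (auto simp: hull_close_def)
  have "hull_cost w A (lift_weights e p) (insert e \<sigma>) = hull_cost w (slice A e) p \<sigma>"
    using assms by (auto simp: hull_cost_def miss_lift_weights intro!: sum.cong)
  then show ?thesis
    unfolding hull_close_def using p \<open>finite A\<close>
    by (intro exI [of _ "lift_weights e p"])
      (auto simp: sum_lift_weights_all, auto simp: lift_weights_def)
qed

text \<open>The geometric core of the induction. The mixed weights are \<open>l\<close> times weights on slice \<open>i\<close> plus \<open>1 - l\<close> times
  weights on slice \<open>j\<close>. The edge in column \<open>j\<close> is missed by all matchings of slice \<open>j\<close>; its cost is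
  covered by the double weight of that column in the hypothesis on slice \<open>i\<close>. The condition on \<open>p\<close> is
  stated so that an empty slice \<open>i\<close> is covered by \<open>l = 0\<close>.\<close>

lemma hull_close_two_slices:
  assumes "finite X" "finite Y" "A \<subseteq> matchings X Y" "r \<in> X" "i \<in> Y" "j \<in> Y" "i \<noteq> j"
    and \<sigma>: "\<sigma> \<in> matchings (X - {r}) (Y - {i})"
    and l: "0 \<le> l" "l \<le> 1"
    and p: "\<And>\<tau>. 0 \<le> p \<tau>" "l * sum p (slice A (r, i)) = l"
    and s: "hull_cost (double_column j) (slice A (r, i)) p \<sigma> \<le> s"
    and q: "\<And>\<tau>. 0 \<le> q \<tau>" "sum q (slice A (r, j)) = 1"
    and t: "hull_cost (\<lambda>_. 1) (slice A (r, j)) q (swap_columns i j \<sigma>) \<le> t"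
  shows "hull_close (double_row r) A (insert (r, i) \<sigma>) (l * s + (1 - l) * t + 4 * (1 - l)\<^sup>2)"
proof -
  have finA: "finite A"
    using assms finite_matchings finite_subset by blast
  have fin\<sigma>: "finite \<sigma>"
    using \<sigma> assms(1,2) finite_matching [of "X - {r}" "Y - {i}" \<sigma>] by simp
  have row: "fst e \<noteq> r" if "e \<in> \<sigma>" for e
    using \<sigma> that unfolding matchings_def by auto
  obtain k \<rho> where \<rho>: "\<sigma> = insert (k, j) \<rho>" "(k, j) \<notin> \<rho>"
    "swap_columns i j \<sigma> = insert (k, i) \<rho>" "(k, i) \<notin> \<rho>" "\<And>e. e \<in> \<rho> \<Longrightarrow> snd e \<noteq> j"
    by (rule swap_columns_decomposition [OF assms(5-8)]) blast
  define P where "P = (\<lambda>\<tau>. l * lift_weights (r, i) p \<tau> + (1 - l) * lift_weights (r, j) q \<tau>)"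
  define u where "u = miss (slice A (r, i)) p"
  define v where "v = miss (slice A (r, j)) q"
  have u: "0 \<le> u e" for e
    unfolding u_def using p(1) by (rule miss_nonneg)
  have v: "0 \<le> v e" "v e \<le> 1" for e
    using miss_nonneg [of q "slice A (r, j)" e, OF q(1)] q(2)
      miss_le_sum [of "slice A (r, j)" q e, OF finite_slice [OF finA] q(1)]
    by (simp_all add: v_def)
  have missP: "miss A P e = l * (if e = (r, i) then 0 else u e) + (1 - l) * (if e = (r, j) then 0 else v e)" for e
    unfolding P_def miss_mix miss_lift_weights [OF finA] u_def v_def by simp
  have fin\<rho>: "finite \<rho>" and k: "k \<noteq> r" and row\<rho>: "\<And>e. e \<in> \<rho> \<Longrightarrow> fst e \<noteq> r"
    using fin\<sigma> row [of "(k, j)"] row \<rho>(1) by simp_all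
  have "hull_cost (double_row r) A P (insert (r, i) \<sigma>) =
      2 * (miss A P (r, i))\<^sup>2 + ((miss A P (k, j))\<^sup>2 + (\<Sum>e\<in>\<rho>. (miss A P e)\<^sup>2))"
  proof -
    have "(r, i) \<notin> insert (k, j) \<rho>"
      using row\<rho> [of "(r, i)"] k by auto
    moreover have "(\<Sum>e\<in>\<rho>. double_row r e * (miss A P e)\<^sup>2) = (\<Sum>e\<in>\<rho>. (miss A P e)\<^sup>2)"
      using row\<rho> by (intro sum.cong) (auto simp: double_row_def)
    ultimately show ?thesis
      using fin\<rho> \<rho>(2) k by (simp add: hull_cost_def \<rho>(1) double_row_def)
  qed
  moreover have "(miss A P (r, i))\<^sup>2 \<le> (1 - l)\<^sup>2"
  proof -
    have "(1 - l) * v (r, i) \<le> (1 - l) * 1"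
      using l v [of "(r, i)"] by (intro mult_left_mono) auto
    then show ?thesis
      using \<open>i \<noteq> j\<close> l v [of "(r, i)"] by (intro power_mono) (auto simp: missP)
  qed
  \<comment> \<open>The cross term \<open>2 * l * u * (1 - l)\<close> is not of second order in \<open>1 - l\<close>; it is split symmetrically.\<close>
  moreover have "(miss A P (k, j))\<^sup>2 \<le> 2 * (l * (u (k, j))\<^sup>2) + 2 * (1 - l)\<^sup>2"
  proof -
    have "(1 - l) * v (k, j) \<le> (1 - l) * 1"
      using l v [of "(k, j)"] by (intro mult_left_mono) auto
    then have "(miss A P (k, j))\<^sup>2 \<le> (l * u (k, j) + (1 - l))\<^sup>2"
      using k l v [of "(k, j)"] u [of "(k, j)"] by (intro power_mono) (auto simp: missP)
    also have "\<dots> \<le> 2 * (l * u (k, j))\<^sup>2 + 2 * (1 - l)\<^sup>2"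
      using sum_squares_bound [of "l * u (k, j)" "1 - l"] by (simp add: power2_sum)
    also have "(l * u (k, j))\<^sup>2 \<le> l * (u (k, j))\<^sup>2"
    proof -
      have "l\<^sup>2 \<le> l" using l by (simp add: power2_eq_square mult_left_le)
      then show ?thesis by (simp add: power_mult_distrib mult_right_mono)
    qed
    finally show ?thesis by simp
  qed
  moreover have "(\<Sum>e\<in>\<rho>. (miss A P e)\<^sup>2) \<le> l * (\<Sum>e\<in>\<rho>. (u e)\<^sup>2) + (1 - l) * (\<Sum>e\<in>\<rho>. (v e)\<^sup>2)"
  proof -
    have "(miss A P e)\<^sup>2 \<le> l * (u e)\<^sup>2 + (1 - l) * (v e)\<^sup>2" if "e \<in> \<rho>" for e
    proof -
      have "e \<noteq> (r, i)" "e \<noteq> (r, j)" using row\<rho> [OF that] by auto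
      then show ?thesis
        using convex_combination_square_le [OF l] by (simp add: missP)
    qed
    from sum_mono [OF this, of \<rho> "\<lambda>e. e"] show ?thesis
      by (simp add: sum.distrib sum_distrib_left)
  qed
  moreover have "2 * (u (k, j))\<^sup>2 + (\<Sum>e\<in>\<rho>. (u e)\<^sup>2) \<le> s"
  proof -
    have "(\<Sum>e\<in>\<rho>. double_column j e * (u e)\<^sup>2) = (\<Sum>e\<in>\<rho>. (u e)\<^sup>2)"
      using \<rho>(5) by (intro sum.cong) (auto simp: double_column_def)
    then show ?thesis
      using s fin\<rho> \<rho>(2) by (simp add: hull_cost_def \<rho>(1) double_column_def u_def)
  qed
  then have "l * (2 * (u (k, j))\<^sup>2 + (\<Sum>e\<in>\<rho>. (u e)\<^sup>2)) \<le> l * s"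
    using l(1) by (rule mult_left_mono)
  then have "2 * (l * (u (k, j))\<^sup>2) + l * (\<Sum>e\<in>\<rho>. (u e)\<^sup>2) \<le> l * s"
    by (simp only: distrib_left mult.left_commute [of l 2])
  moreover have "(v (k, i))\<^sup>2 + (\<Sum>e\<in>\<rho>. (v e)\<^sup>2) \<le> t"
    using t fin\<rho> \<rho>(4) by (simp add: hull_cost_def \<rho>(3) v_def)
  then have "(\<Sum>e\<in>\<rho>. (v e)\<^sup>2) \<le> t"
    using zero_le_power2 [of "v (k, i)"] by linarith
  then have "(1 - l) * (\<Sum>e\<in>\<rho>. (v e)\<^sup>2) \<le> (1 - l) * t"
    using l(2) by (simp add: mult_left_mono)
  ultimately have "hull_cost (double_row r) A P (insert (r, i) \<sigma>) \<le> l * s + (1 - l) * t + 4 * (1 - l)\<^sup>2"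
    by linarith
  moreover have "sum P A = l * sum p (slice A (r, i)) + (1 - l) * sum q (slice A (r, j))"
    unfolding P_def sum.distrib sum_distrib_left [symmetric] sum_lift_weights_all [OF finA] ..
  then have "sum P A = 1"
    unfolding p(2) q(2) by simp
  moreover have "0 \<le> P \<tau>" for \<tau>
    using p(1) q(1) l by (simp add: P_def lift_weights_def)
  ultimately show ?thesis
    unfolding hull_close_def by (intro exI [of _ P]) simp
qed

section \<open>Talagrand's inequality for one slice\<close>

text \<open>Talagrand's inequality in counting form, with \<open>F\<close> a majorant of the weighted squared convex
  distance.\<close>

definition talagrand_bound :: "('a \<times> 'b \<Rightarrow> real) \<Rightarrow> 'a set \<Rightarrow> 'b set \<Rightarrow> bool" where
  "talagrand_bound w X Y \<longleftrightarrow> (\<forall>A \<subseteq> matchings X Y. A \<noteq> {} \<longrightarrow>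
     (\<exists>F. (\<forall>\<sigma> \<in> matchings X Y. hull_close w A \<sigma> (F \<sigma>)) \<and>
       real (card A) * (\<Sum>\<sigma>\<in>matchings X Y. exp (F \<sigma> / 16)) \<le> (real (card (matchings X Y)))\<^sup>2))"

lemma hull_close_converse:
  assumes "hull_close w (converse ` A) (\<sigma>\<inverse>) t"
  shows "hull_close (\<lambda>e. w (prod.swap e)) A \<sigma> t"
proof -
  obtain p where p: "\<And>\<tau>. 0 \<le> p \<tau>" "sum p (converse ` A) = 1" "hull_cost w (converse ` A) p (\<sigma>\<inverse>) \<le> t"
    using assms by (auto simp: hull_close_def)
  have inj: "inj_on converse B" for B :: "('x \<times> 'y) set set"
    by (rule inj_onI) simp
  have miss: "miss A (\<lambda>\<tau>. p (\<tau>\<inverse>)) e = miss (converse ` A) p (prod.swap e)" for e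
  proof -
    have "{\<tau> \<in> converse ` A. prod.swap e \<notin> \<tau>} = converse ` {\<tau> \<in> A. e \<notin> \<tau>}"
      by (cases e) auto
    then show ?thesis
      by (simp add: miss_def sum.reindex [OF inj])
  qed
  have "\<sigma>\<inverse> = prod.swap ` \<sigma>"
    by force
  then have "hull_cost (\<lambda>e. w (prod.swap e)) A (\<lambda>\<tau>. p (\<tau>\<inverse>)) \<sigma> = hull_cost w (converse ` A) p (\<sigma>\<inverse>)"
    by (simp add: hull_cost_def miss sum.reindex)
  then show ?thesis
    unfolding hull_close_def using p
    by (intro exI [of _ "\<lambda>\<tau>. p (\<tau>\<inverse>)"]) (simp add: sum.reindex [OF inj])
qed

text \<open>Transposing the bipartite graph preserves convex distances, and exchanges weights on rows and on
  columns.\<close>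

lemma talagrand_bound_converse:
  assumes "talagrand_bound w X Y"
  shows "talagrand_bound (\<lambda>e. w (prod.swap e)) Y X"
  unfolding talagrand_bound_def
proof (intro allI impI)
  fix A assume A: "A \<subseteq> matchings Y X" "A \<noteq> {}"
  have "converse ` A \<subseteq> matchings X Y" "converse ` A \<noteq> {}"
    using A matching_converse by auto
  then obtain F where F: "\<And>\<sigma>. \<sigma> \<in> matchings X Y \<Longrightarrow> hull_close w (converse ` A) \<sigma> (F \<sigma>)"
    "real (card (converse ` A)) * (\<Sum>\<sigma>\<in>matchings X Y. exp (F \<sigma> / 16)) \<le> (real (card (matchings X Y)))\<^sup>2"
    using assms [unfolded talagrand_bound_def, rule_format, of "converse ` A"] by blast
  have "card (converse ` A) = card A"
    by (intro card_image inj_onI) simp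
  moreover have "(\<Sum>\<sigma>\<in>matchings Y X. exp (F (\<sigma>\<inverse>) / 16)) = (\<Sum>\<sigma>\<in>matchings X Y. exp (F \<sigma> / 16))"
    by (rule sum.reindex_bij_betw [OF bij_betw_converse_matchings])
  moreover have "card (matchings Y X) = card (matchings X Y)"
    by (rule bij_betw_same_card [OF bij_betw_converse_matchings])
  ultimately show "\<exists>F. (\<forall>\<sigma>\<in>matchings Y X. hull_close (\<lambda>e. w (prod.swap e)) A \<sigma> (F \<sigma>)) \<and>
      real (card A) * (\<Sum>\<sigma>\<in>matchings Y X. exp (F \<sigma> / 16)) \<le> (real (card (matchings Y X)))\<^sup>2"
    using F by (intro exI [of _ "\<lambda>\<sigma>. F (\<sigma>\<inverse>)"]) (auto intro!: hull_close_converse matching_converse)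
qed

text \<open>The bound for slice \<open>i\<close>, relative to a slice \<open>j\<close> that is at least as large. For \<open>i \<noteq> j\<close> the distance is
  estimated by a mixture of the two slices, the sum of exponentials by Hoelder's inequality, and the
  mixture parameter is the one of the scalar inequality. An empty slice leaves only \<open>l = 0\<close>, where the
  factor \<open>exp (4 / 16)\<close> is still below 2.\<close>

lemma talagrand_bound_slice:
  assumes fin: "finite X" "finite Y" and A: "A \<subseteq> matchings X Y" and r: "r \<in> X"
    and i: "i \<in> Y" and j: "j \<in> Y"
    and IH: "\<And>y. y \<in> Y \<Longrightarrow> talagrand_bound (double_column j) (X - {r}) (Y - {y})"
    and c: "card (slice A (r, i)) \<le> card (slice A (r, j))" "0 < card (slice A (r, j))"
    and N: "N = real (card (matchings (X - {r}) (Y - {j})))"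
  shows "\<exists>F. (\<forall>\<sigma>\<in>matchings (X - {r}) (Y - {i}). hull_close (double_row r) A (insert (r, i) \<sigma>) (F \<sigma>)) \<and>
    (\<Sum>\<sigma>\<in>matchings (X - {r}) (Y - {i}). exp (F \<sigma> / 16)) \<le>
      N\<^sup>2 / card (slice A (r, j)) * (2 - card (slice A (r, i)) / card (slice A (r, j)))"
proof -
  let ?M = "\<lambda>y. matchings (X - {r}) (Y - {y})"
  define a where "a = real (card (slice A (r, i)))"
  define b where "b = real (card (slice A (r, j)))"
  have ab: "0 \<le> a" "a \<le> b" "0 < b"
    using c by (auto simp: a_def b_def)
  have finA: "finite A"
    using A fin finite_matchings finite_subset by blast
  have sub: "slice A (r, y) \<subseteq> ?M y" if "y \<in> Y" for y
    using slice_mono [OF A] slice_matchings [OF r that] by blast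
  have finM: "finite (?M y)" for y
    using fin by (simp add: finite_matchings)
  have row: "fst e \<noteq> r" if "e \<in> \<sigma>" "\<sigma> \<in> ?M y" for e \<sigma> y
    using that unfolding matchings_def by auto
  have "slice A (r, j) \<noteq> {}"
    using c(2) by auto
  then have "0 < N"
    using sub [OF j] finM [of j] by (auto simp: N card_gt_0_iff)
  have cardM: "card (?M i) = card (?M j)"
    by (rule bij_betw_same_card [OF bij_betw_swap_columns [OF i j]])
  obtain G where G: "\<And>\<sigma>. \<sigma> \<in> ?M j \<Longrightarrow> hull_close (double_column j) (slice A (r, j)) \<sigma> (G \<sigma>)"
    and Gsum: "b * (\<Sum>\<sigma>\<in>?M j. exp (G \<sigma> / 16)) \<le> N\<^sup>2"
    using IH [OF j, unfolded talagrand_bound_def, rule_format, OF sub [OF j] \<open>slice A (r, j) \<noteq> {}\<close>]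
    unfolding N b_def by blast
  have Gsum: "(\<Sum>\<sigma>\<in>?M j. exp (G \<sigma> / 16)) \<le> N\<^sup>2 / b"
    using Gsum ab by (simp add: field_simps)
  show ?thesis
    unfolding a_def [symmetric] b_def [symmetric]
  proof (cases "i = j")
    case True
    have "hull_close (double_row r) A (insert (r, i) \<sigma>) (G \<sigma>)" if "\<sigma> \<in> ?M i" for \<sigma>
    proof (rule hull_close_same_slice [OF finA])
      show "finite \<sigma>"
        using finite_matching [OF _ _ that] fin by simp
      show "(r, i) \<notin> \<sigma>"
        using row [of "(r, i)", OF _ that] by auto
      show "hull_close (double_row r) (slice A (r, i)) \<sigma> (G \<sigma>)"
      proof (rule hull_close_mono)
        show "hull_close (double_column j) (slice A (r, i)) \<sigma> (G \<sigma>)"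
          using G that True by simp
        show "double_row r e \<le> double_column j e" if "e \<in> \<sigma>" for e
          using row [OF that \<open>\<sigma> \<in> ?M i\<close>] by (simp add: double_row_def double_column_def)
      qed
    qed
    moreover have "a = b"
      using True by (simp add: a_def b_def)
    ultimately show "\<exists>F. (\<forall>\<sigma>\<in>?M i. hull_close (double_row r) A (insert (r, i) \<sigma>) (F \<sigma>)) \<and>
        (\<Sum>\<sigma>\<in>?M i. exp (F \<sigma> / 16)) \<le> N\<^sup>2 / b * (2 - a / b)"
      using Gsum ab True by (intro exI [of _ G]) simp
  next
    case False
    have G1: "hull_close (\<lambda>_. 1) (slice A (r, j)) (swap_columns i j \<sigma>) (G (swap_columns i j \<sigma>))"
      if "\<sigma> \<in> ?M i" for \<sigma>
      using G [OF swap_columns_matching [OF i j that]]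
      by (rule hull_close_mono) (simp add: double_column_def)
    have Gswap: "(\<Sum>\<sigma>\<in>?M i. exp (G (swap_columns i j \<sigma>) / 16)) \<le> N\<^sup>2 / b"
      using Gsum sum.reindex_bij_betw [OF bij_betw_swap_columns [OF i j], of "\<lambda>\<sigma>. exp (G \<sigma> / 16)"]
      by simp
    show "\<exists>F. (\<forall>\<sigma>\<in>?M i. hull_close (double_row r) A (insert (r, i) \<sigma>) (F \<sigma>)) \<and>
        (\<Sum>\<sigma>\<in>?M i. exp (F \<sigma> / 16)) \<le> N\<^sup>2 / b * (2 - a / b)"
    proof (cases "a = 0")
      case True
      then have empty: "slice A (r, i) = {}"
        using finite_slice [OF finA] by (simp add: a_def)
      define F where "F = (\<lambda>\<sigma>. G (swap_columns i j \<sigma>) + 4)"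
      have "hull_close (double_row r) A (insert (r, i) \<sigma>) (F \<sigma>)" if \<sigma>: "\<sigma> \<in> ?M i" for \<sigma>
      proof -
        obtain q where q: "\<And>\<tau>. 0 \<le> q \<tau>" "sum q (slice A (r, j)) = 1"
          "hull_cost (\<lambda>_. 1) (slice A (r, j)) q (swap_columns i j \<sigma>) \<le> G (swap_columns i j \<sigma>)"
          using G1 [OF \<sigma>] by (auto simp: hull_close_def)
        show ?thesis
          using hull_close_two_slices [OF fin A r i j False \<sigma>, of 0 "\<lambda>_. 0" 0, OF _ _ _ _ _ q]
          by (simp add: empty hull_cost_def miss_def F_def)
      qed
      moreover have "(\<Sum>\<sigma>\<in>?M i. exp (F \<sigma> / 16)) \<le> N\<^sup>2 / b * (2 - a / b)"
      proof -
        have "exp (1/4 :: real) \<le> 1 + 1/4 + (1/4)\<^sup>2"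
          by (rule exp_bound) auto
        then have "exp (1/4 :: real) \<le> 2"
          by (simp add: power2_eq_square)
        have "(\<Sum>\<sigma>\<in>?M i. exp (F \<sigma> / 16)) = exp (1/4) * (\<Sum>\<sigma>\<in>?M i. exp (G (swap_columns i j \<sigma>) / 16))"
          by (simp add: F_def add_divide_distrib exp_add sum_distrib_left mult.commute)
        also have "\<dots> \<le> 2 * (N\<^sup>2 / b)"
          using Gswap \<open>exp (1/4) \<le> 2\<close> by (intro mult_mono) (auto intro: sum_nonneg)
        finally show ?thesis
          using True by (simp add: mult.commute)
      qed
      ultimately show ?thesis by blast
    next
      case a: False
      then have "slice A (r, i) \<noteq> {}" and "0 < a"
        using ab by (auto simp: a_def)
      obtain H where H: "\<And>\<sigma>. \<sigma> \<in> ?M i \<Longrightarrow> hull_close (double_column j) (slice A (r, i)) \<sigma> (H \<sigma>)"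
        and Hsum: "a * (\<Sum>\<sigma>\<in>?M i. exp (H \<sigma> / 16)) \<le> N\<^sup>2"
        using IH [OF i, unfolded talagrand_bound_def, rule_format, OF sub [OF i] \<open>slice A (r, i) \<noteq> {}\<close>]
        unfolding N a_def cardM by blast
      have Hsum: "(\<Sum>\<sigma>\<in>?M i. exp (H \<sigma> / 16)) \<le> N\<^sup>2 / a"
        using Hsum \<open>0 < a\<close> by (simp add: field_simps)
      obtain l where l: "0 \<le> l" "l \<le> 1" "exp ((1 - l)\<^sup>2 / 4) * (a / b) powr (- l) \<le> 2 - a / b"
        using talagrand_scalar_inequality [of "a / b"] \<open>0 < a\<close> ab by auto
      define F where "F = (\<lambda>\<sigma>. l * H \<sigma> + (1 - l) * G (swap_columns i j \<sigma>) + 4 * (1 - l)\<^sup>2)"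
      have "hull_close (double_row r) A (insert (r, i) \<sigma>) (F \<sigma>)" if \<sigma>: "\<sigma> \<in> ?M i" for \<sigma>
      proof -
        obtain p where p: "\<And>\<tau>. 0 \<le> p \<tau>" "sum p (slice A (r, i)) = 1"
          "hull_cost (double_column j) (slice A (r, i)) p \<sigma> \<le> H \<sigma>"
          using H [OF \<sigma>] by (auto simp: hull_close_def)
        obtain q where q: "\<And>\<tau>. 0 \<le> q \<tau>" "sum q (slice A (r, j)) = 1"
          "hull_cost (\<lambda>_. 1) (slice A (r, j)) q (swap_columns i j \<sigma>) \<le> G (swap_columns i j \<sigma>)"
          using G1 [OF \<sigma>] by (auto simp: hull_close_def)
        show ?thesis
          using hull_close_two_slices [OF fin A r i j False \<sigma> l(1,2) p(1) _ p(3) q] p(2)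
          by (simp add: F_def)
      qed
      moreover have "(\<Sum>\<sigma>\<in>?M i. exp (F \<sigma> / 16)) \<le> N\<^sup>2 / b * (2 - a / b)"
      proof -
        have "exp (F \<sigma> / 16) = exp ((1 - l)\<^sup>2 / 4) *
            exp (l * (H \<sigma> / 16) + (1 - l) * (G (swap_columns i j \<sigma>) / 16))" for \<sigma>
          by (simp add: F_def add_divide_distrib exp_add)
        then have "(\<Sum>\<sigma>\<in>?M i. exp (F \<sigma> / 16)) = exp ((1 - l)\<^sup>2 / 4) *
            (\<Sum>\<sigma>\<in>?M i. exp (l * (H \<sigma> / 16) + (1 - l) * (G (swap_columns i j \<sigma>) / 16)))"
          by (simp add: sum_distrib_left)
        also have "\<dots> \<le> exp ((1 - l)\<^sup>2 / 4) * ((N\<^sup>2 / a) powr l * (N\<^sup>2 / b) powr (1 - l))"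
          using finM l(1,2) Hsum Gswap \<open>0 < a\<close> ab \<open>0 < N\<close>
          by (intro mult_left_mono sum_exp_convex_combination_le) auto
        also have "(N\<^sup>2 / a) powr l * (N\<^sup>2 / b) powr (1 - l) = N\<^sup>2 / b * (a / b) powr (- l)"
          using \<open>0 < a\<close> ab \<open>0 < N\<close>
          by (simp add: powr_def exp_add [symmetric] ln_div ln_mult exp_diff [symmetric] algebra_simps)
            (simp add: exp_diff exp_add mult.commute)
        also have "exp ((1 - l)\<^sup>2 / 4) * \<dots> = N\<^sup>2 / b * (exp ((1 - l)\<^sup>2 / 4) * (a / b) powr (- l))"
          by simp
        also have "\<dots> \<le> N\<^sup>2 / b * (2 - a / b)"
          using l ab by (intro mult_left_mono) auto
        finally show ?thesis .
      qed
      ultimately show ?thesis by blast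
    qed
  qed
qed

section \<open>Talagrand's inequality for perfect matchings\<close>

text \<open>With \<open>n\<close> slices, of which the largest meets \<open>A\<close> in \<open>c j\<close> matchings, and \<open>u = card A / c j\<close>, summing the
  bounds for the slices gives the factor \<open>u * (2 * n - u)\<close>, which is at most \<open>n\<^sup>2\<close>.\<close>

lemma talagrand_bound_step:
  assumes fin: "finite X" "finite Y" and r: "r \<in> X"
    and IH: "\<And>i c. i \<in> Y \<Longrightarrow> talagrand_bound (double_column c) (X - {r}) (Y - {i})"
  shows "talagrand_bound (double_row r) X Y"
  unfolding talagrand_bound_def
proof (intro allI impI)
  fix A assume A: "A \<subseteq> matchings X Y" and "A \<noteq> {}"
  let ?M = "\<lambda>y. matchings (X - {r}) (Y - {y})"
  define c where "c = (\<lambda>i. card (slice A (r, i)))"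
  have "finite A"
    using A fin finite_matchings finite_subset by blast
  then have "0 < real (card A)"
    using \<open>A \<noteq> {}\<close> by (simp add: card_gt_0_iff)
  have cardA: "real (card A) = (\<Sum>i\<in>Y. real (c i))"
    using sum_matchings_by_slices [OF fin r A, of "\<lambda>_. 1"] by (simp add: c_def)
  then have "Y \<noteq> {}"
    using \<open>0 < real (card A)\<close> by auto
  then obtain j where j: "j \<in> Y" "\<And>i. i \<in> Y \<Longrightarrow> c i \<le> c j"
    using Max_in [of "c ` Y"] Max_ge [of "c ` Y"] fin(2) by fastforce
  have "0 < c j"
  proof (rule ccontr)
    assume "\<not> 0 < c j"
    then have "c i = 0" if "i \<in> Y" for i
      using j(2) [OF that] by simp
    then show False
      using cardA \<open>0 < real (card A)\<close> by simp
  qed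
  define N where "N = real (card (?M j))"
  have "\<exists>F. (\<forall>\<sigma>\<in>?M i. hull_close (double_row r) A (insert (r, i) \<sigma>) (F \<sigma>)) \<and>
      (\<Sum>\<sigma>\<in>?M i. exp (F \<sigma> / 16)) \<le> N\<^sup>2 / c j * (2 - c i / c j)" if "i \<in> Y" for i
    using talagrand_bound_slice [OF fin A r that j(1) IH _ _ N_def] j(2) [OF that] \<open>0 < c j\<close>
    by (simp add: c_def)
  then obtain \<Phi> where \<Phi>: "\<And>i \<sigma>. i \<in> Y \<Longrightarrow> \<sigma> \<in> ?M i \<Longrightarrow>
      hull_close (double_row r) A (insert (r, i) \<sigma>) (\<Phi> i \<sigma>)"
    and \<Phi>sum: "\<And>i. i \<in> Y \<Longrightarrow> (\<Sum>\<sigma>\<in>?M i. exp (\<Phi> i \<sigma> / 16)) \<le> N\<^sup>2 / c j * (2 - c i / c j)"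
    by metis
  \<comment> \<open>The majorants of the slices are glued along the partner of \<open>r\<close>.\<close>
  define F where "F = (\<lambda>\<tau>. let i = THE i. (r, i) \<in> \<tau> in \<Phi> i (\<tau> - {(r, i)}))"
  have F: "F (insert (r, i) \<sigma>) = \<Phi> i \<sigma>" if "\<sigma> \<in> ?M i" for i \<sigma>
  proof -
    have "(r, y) \<notin> \<sigma>" for y
      using that by (auto simp: matchings_def)
    then have "(THE y. (r, y) \<in> insert (r, i) \<sigma>) = i" "insert (r, i) \<sigma> - {(r, i)} = \<sigma>"
      by auto
    then show ?thesis
      by (simp add: F_def Let_def)
  qed
  have "hull_close (double_row r) A \<tau> (F \<tau>)" if \<tau>: "\<tau> \<in> matchings X Y" for \<tau>
  proof -
    obtain i where i: "i \<in> Y" "(r, i) \<in> \<tau>"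
      using \<tau> r unfolding matchings_def by blast
    then have ins: "\<tau> = insert (r, i) (\<tau> - {(r, i)})"
      by auto
    then have "\<tau> - {(r, i)} \<in> slice (matchings X Y) (r, i)"
      using \<tau> by (simp add: slice_def insert_absorb i)
    then have M: "\<tau> - {(r, i)} \<in> ?M i"
      using slice_matchings [OF r i(1)] by simp
    show ?thesis
      using \<Phi> [OF i(1) M] F [OF M] ins by simp
  qed
  moreover have "real (card A) * (\<Sum>\<tau>\<in>matchings X Y. exp (F \<tau> / 16)) \<le> (real (card (matchings X Y)))\<^sup>2"
  proof -
    have cardM: "card (?M i) = card (?M j)" if "i \<in> Y" for i
      by (rule bij_betw_same_card [OF bij_betw_swap_columns [OF that j(1)]])
    define n where "n = real (card Y)"
    define u where "u = real (card A) / c j"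
    have "real (card (matchings X Y)) = (\<Sum>i\<in>Y. real (card (?M i)))"
      using sum_matchings_by_slices [OF fin r subset_refl, of "\<lambda>_. 1"] by (simp add: slice_matchings [OF r])
    then have total: "real (card (matchings X Y)) = n * N"
      using cardM by (simp add: n_def N_def)
    have "(\<Sum>\<tau>\<in>matchings X Y. exp (F \<tau> / 16)) = (\<Sum>i\<in>Y. \<Sum>\<sigma>\<in>?M i. exp (\<Phi> i \<sigma> / 16))"
      using sum_matchings_by_slices [OF fin r subset_refl, of "\<lambda>\<tau>. exp (F \<tau> / 16)"]
      by (simp add: slice_matchings [OF r] F)
    also have "\<dots> \<le> (\<Sum>i\<in>Y. N\<^sup>2 / c j * (2 - c i / c j))"
      using \<Phi>sum by (rule sum_mono)
    also have "\<dots> = N\<^sup>2 / c j * (2 * n - u)"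
      by (simp add: sum_distrib_left [symmetric] sum_subtractf sum_divide_distrib [symmetric] cardA n_def u_def)
    finally have "real (card A) * (\<Sum>\<tau>\<in>matchings X Y. exp (F \<tau> / 16)) \<le>
        real (card A) * (N\<^sup>2 / c j * (2 * n - u))"
      by (intro mult_left_mono) auto
    also have "\<dots> = N\<^sup>2 * (u * (2 * n - u))"
      by (simp add: u_def)
    also have "\<dots> \<le> N\<^sup>2 * n\<^sup>2"
    proof -
      have "0 \<le> (n - u)\<^sup>2" by simp
      then have "u * (2 * n - u) \<le> n\<^sup>2"
        by (simp add: power2_eq_square algebra_simps)
      then show ?thesis
        by (intro mult_left_mono) auto
    qed
    finally show ?thesis
      by (simp add: total power_mult_distrib mult.commute)
  qed
  ultimately show "\<exists>F. (\<forall>\<sigma>\<in>matchings X Y. hull_close (double_row r) A \<sigma> (F \<sigma>)) \<and>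
      real (card A) * (\<Sum>\<sigma>\<in>matchings X Y. exp (F \<sigma> / 16)) \<le> (real (card (matchings X Y)))\<^sup>2"
    by blast
qed

lemma talagrand_bound_mono:
  assumes "talagrand_bound w' X Y"
    and w: "\<And>\<sigma> e. \<sigma> \<in> matchings X Y \<Longrightarrow> e \<in> \<sigma> \<Longrightarrow> w e \<le> w' e"
  shows "talagrand_bound w X Y"
  unfolding talagrand_bound_def
proof (intro allI impI)
  fix A assume "A \<subseteq> matchings X Y" "A \<noteq> {}"
  then obtain F where "\<And>\<sigma>. \<sigma> \<in> matchings X Y \<Longrightarrow> hull_close w' A \<sigma> (F \<sigma>)"
    "real (card A) * (\<Sum>\<sigma>\<in>matchings X Y. exp (F \<sigma> / 16)) \<le> (real (card (matchings X Y)))\<^sup>2"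
    using assms(1) [unfolded talagrand_bound_def, rule_format, of A] by blast
  moreover from this(1) have "hull_close w A \<sigma> (F \<sigma>)" if "\<sigma> \<in> matchings X Y" for \<sigma>
    using that w [OF that] by (blast intro: hull_close_mono)
  ultimately show "\<exists>F. (\<forall>\<sigma>\<in>matchings X Y. hull_close w A \<sigma> (F \<sigma>)) \<and>
      real (card A) * (\<Sum>\<sigma>\<in>matchings X Y. exp (F \<sigma> / 16)) \<le> (real (card (matchings X Y)))\<^sup>2"
    by blast
qed

text \<open>The induction needs the inequality with a doubled column for a smaller graph. This is the
  inequality with a doubled row for the transposed graph, so the induction is over the total number
  of vertices, and both sides have the same type. A row \<open>r\<close> outside of \<open>X\<close> means that no edge is doubled.\<close>

theorem talagrand_bound_double_row:
  fixes X Y :: "'a set"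
  assumes "finite X" "finite Y"
  shows "talagrand_bound (double_row r) X Y"
  using assms
proof (induction "card X + card Y" arbitrary: X Y r rule: less_induct)
  case less
  show ?case
  proof (cases "X = {}")
    case True
    show ?thesis
      unfolding talagrand_bound_def
    proof (intro allI impI)
      fix A :: "('a \<times> 'a) set set" assume A: "A \<subseteq> matchings X Y" "A \<noteq> {}"
      have sub: "matchings X Y \<subseteq> {{}}"
        using True by (auto simp: matchings_def)
      then have "A = {{}}"
        using A(2) subset_trans [OF A(1) sub] by (simp add: subset_singleton_iff)
      moreover have "matchings X Y = {{}}"
        using A(1) sub \<open>A = {{}}\<close> by (intro subset_antisym) simp_all
      moreover have "hull_close (double_row r) {{}} {} 0"
        unfolding hull_close_def by (intro exI [of _ "\<lambda>_. 1"]) (simp add: hull_cost_def)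
      ultimately show "\<exists>F. (\<forall>\<sigma>\<in>matchings X Y. hull_close (double_row r) A \<sigma> (F \<sigma>)) \<and>
          real (card A) * (\<Sum>\<sigma>\<in>matchings X Y. exp (F \<sigma> / 16)) \<le> (real (card (matchings X Y)))\<^sup>2"
        by (intro exI [of _ "\<lambda>_. 0"]) simp
    qed
  next
    case False
    have main: "talagrand_bound (double_row r') X Y" if r': "r' \<in> X" for r'
    proof (rule talagrand_bound_step [OF less.prems r'])
      fix i c assume i: "i \<in> Y"
      have "card (X - {r'}) < card X" "card (Y - {i}) < card Y"
        by (rule card_Diff1_less [OF less.prems(1) r'], rule card_Diff1_less [OF less.prems(2) i])
      then have "talagrand_bound (double_row c) (Y - {i}) (X - {r'})"
        using less.prems by (intro less.hyps) simp_all
      from talagrand_bound_converse [OF this]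
      show "talagrand_bound (double_column c) (X - {r'}) (Y - {i})"
        by (simp add: double_row_def double_column_def [abs_def])
    qed
    show ?thesis
    proof (cases "r \<in> X")
      case False
      obtain r' where "r' \<in> X"
        using \<open>X \<noteq> {}\<close> by blast
      show ?thesis
      proof (rule talagrand_bound_mono [OF main [OF \<open>r' \<in> X\<close>]])
        fix \<sigma> and e :: "'a \<times> 'a"
        assume "\<sigma> \<in> matchings X Y" "e \<in> \<sigma>"
        then have "fst e \<in> X"
          by (auto simp: matchings_def)
        then show "double_row r e \<le> double_row r' e"
          using False by (auto simp: double_row_def)
      qed
    qed (rule main)
  qed
qed

corollary talagrand_bound_unweighted:
  fixes X Y :: "'a set"
  assumes "finite X" "finite Y"
  shows "talagrand_bound (\<lambda>_. 1) X Y"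
  by (rule talagrand_bound_mono [OF talagrand_bound_double_row [OF assms]])
    (simp add: double_row_def)

lemma card_matchings_le:
  fixes X :: "'a set" and Y :: "'b set"
  assumes "finite X" "finite Y"
  shows "card (matchings X Y) \<le> fact (card Y)"
  using assms
proof (induction X arbitrary: Y rule: finite_induct)
  case empty
  have "card (matchings ({} :: 'a set) Y) \<le> card {{} :: ('a \<times> 'b) set}"
    by (rule card_mono) (auto simp: matchings_def)
  also have "\<dots> \<le> fact (card Y)"
    by simp
  finally show ?case .
next
  case (insert r X)
  have "real (card (matchings (insert r X) Y)) = (\<Sum>i\<in>Y. real (card (matchings X (Y - {i}))))"
    using sum_matchings_by_slices [of "insert r X" Y r "matchings (insert r X) Y" "\<lambda>_. 1"] insert
    by (simp add: slice_matchings)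
  also have "\<dots> \<le> (\<Sum>i\<in>Y. fact (card Y - 1))"
  proof (rule sum_mono)
    fix i assume "i \<in> Y"
    then have "card (matchings X (Y - {i})) \<le> fact (card Y - 1)"
      using insert.IH [of "Y - {i}"] insert.prems by simp
    then show "real (card (matchings X (Y - {i}))) \<le> fact (card Y - 1)"
      by (metis of_nat_fact of_nat_le_iff)
  qed
  also have "\<dots> \<le> fact (card Y)"
    by (cases "card Y") simp_all
  finally show ?case
    by (metis of_nat_fact of_nat_le_iff)
qed

section \<open>From convex distance to permuted sums\<close>

text \<open>The dual description of the convex distance. Some member of \<open>A\<close> has at most the average gap with
  respect to \<open>p\<close>. Since \<open>\<beta>\<close> is nonnegative, only the edges missed by \<open>\<tau>\<close> contribute positively to a gap, so the average is
  at most the inner product of \<open>\<beta>\<close> with the vector of missed masses. The Cauchy-Schwarz inequality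
  concludes.\<close>

lemma hull_close_imp_gap:
  fixes \<beta> :: "'e \<Rightarrow> real"
  assumes "finite A" "finite \<sigma>" "\<And>\<tau>. \<tau> \<in> A \<Longrightarrow> finite \<tau>"
    and nonneg: "\<And>\<tau> e. \<tau> \<in> insert \<sigma> A \<Longrightarrow> e \<in> \<tau> \<Longrightarrow> 0 \<le> \<beta> e"
    and close: "hull_close (\<lambda>_. 1) A \<sigma> s"
    and t: "0 \<le> t"
    and gap: "\<And>\<tau>. \<tau> \<in> A \<Longrightarrow> t * sqrt (\<Sum>e\<in>\<sigma>. (\<beta> e)\<^sup>2) < sum \<beta> \<sigma> - sum \<beta> \<tau>"
  shows "t\<^sup>2 \<le> s"
proof -
  obtain p where p: "\<And>\<tau>. 0 \<le> p \<tau>" "sum p A = 1" and cost: "hull_cost (\<lambda>_. 1) A p \<sigma> \<le> s"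
    using close by (auto simp: hull_close_def)
  define R where "R = sqrt (\<Sum>e\<in>\<sigma>. (\<beta> e)\<^sup>2)"
  define g where "g = Min ((\<lambda>\<tau>. sum \<beta> \<sigma> - sum \<beta> \<tau>) ` A)"
  have "0 \<le> R"
    by (simp add: R_def sum_nonneg)
  have "A \<noteq> {}"
    using p by auto
  then have "t * R < g"
    using gap \<open>finite A\<close> by (simp add: g_def R_def)
  have "g = (\<Sum>\<tau>\<in>A. p \<tau> * g)"
    using p by (simp add: sum_distrib_right [symmetric])
  also have "\<dots> \<le> (\<Sum>\<tau>\<in>A. p \<tau> * (\<Sum>e\<in>\<sigma>. if e \<notin> \<tau> then \<beta> e else 0))"
  proof (intro sum_mono mult_left_mono p)
    fix \<tau> assume \<tau>: "\<tau> \<in> A"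
    have "sum \<beta> (\<sigma> \<inter> \<tau>) \<le> sum \<beta> \<tau>"
      using assms(3) [OF \<tau>] nonneg \<tau> by (intro sum_mono2) auto
    moreover have "sum \<beta> \<sigma> = sum \<beta> (\<sigma> \<inter> \<tau>) + sum \<beta> (\<sigma> - \<tau>)"
      using \<open>finite \<sigma>\<close> by (rule sum.Int_Diff)
    moreover have "sum \<beta> (\<sigma> - \<tau>) = (\<Sum>e\<in>\<sigma>. if e \<notin> \<tau> then \<beta> e else 0)"
      using \<open>finite \<sigma>\<close> by (simp add: sum.inter_filter [symmetric] set_diff_eq)
    moreover have "g \<le> sum \<beta> \<sigma> - sum \<beta> \<tau>"
      using \<tau> \<open>finite A\<close> by (simp add: g_def)
    ultimately show "g \<le> (\<Sum>e\<in>\<sigma>. if e \<notin> \<tau> then \<beta> e else 0)"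
      by linarith
  qed
  also have "\<dots> = (\<Sum>e\<in>\<sigma>. \<Sum>\<tau>\<in>A. p \<tau> * (if e \<notin> \<tau> then \<beta> e else 0))"
    by (simp only: sum_distrib_left sum.swap [of _ A])
  also have "\<dots> = (\<Sum>e\<in>\<sigma>. \<beta> e * miss A p e)"
  proof (rule sum.cong [OF refl])
    fix e
    have "miss A p e = (\<Sum>\<tau>\<in>A. if e \<notin> \<tau> then p \<tau> else 0)"
      using \<open>finite A\<close> by (simp add: miss_def sum.inter_filter)
    then show "(\<Sum>\<tau>\<in>A. p \<tau> * (if e \<notin> \<tau> then \<beta> e else 0)) = \<beta> e * miss A p e"
      by (auto simp: sum_distrib_left intro!: sum.cong)
  qed
  also have "\<dots> \<le> R * sqrt (hull_cost (\<lambda>_. 1) A p \<sigma>)"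
  proof -
    have "(\<Sum>e\<in>\<sigma>. \<beta> e * miss A p e)\<^sup>2 \<le> (\<Sum>e\<in>\<sigma>. (\<beta> e)\<^sup>2) * (\<Sum>e\<in>\<sigma>. (miss A p e)\<^sup>2)"
      by (rule Cauchy_Schwarz_ineq_sum)
    then have "(\<Sum>e\<in>\<sigma>. \<beta> e * miss A p e) \<le> sqrt ((\<Sum>e\<in>\<sigma>. (\<beta> e)\<^sup>2) * (\<Sum>e\<in>\<sigma>. (miss A p e)\<^sup>2))"
      by (rule real_le_rsqrt)
    then show ?thesis
      by (simp add: R_def hull_cost_def real_sqrt_mult)
  qed
  also have "\<dots> \<le> R * sqrt s"
    using cost \<open>0 \<le> R\<close> by (intro mult_left_mono) auto
  finally have "R * t < R * sqrt s"
    using \<open>t * R < g\<close> by (simp add: mult.commute)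
  then have "t < sqrt s"
    using \<open>0 \<le> R\<close> by (simp add: mult_less_cancel_left)
  then show ?thesis
    using t real_less_rsqrt sqrt_ge_absD by fastforce
qed

lemma permutation_graph_matching:
  assumes "\<pi> permutes S"
  shows "(\<lambda>i. (i, \<pi> i)) ` S \<in> matchings S S"
proof -
  have "\<exists>!x. (x, y) \<in> (\<lambda>i. (i, \<pi> i)) ` S" if "y \<in> S" for y
  proof -
    have "inv \<pi> y \<in> S"
      using permutes_in_image [OF permutes_inv [OF assms]] that by simp
    then have "(x, y) \<in> (\<lambda>i. (i, \<pi> i)) ` S \<longleftrightarrow> x = inv \<pi> y" for x
      using permutes_inv_eq [OF assms, of y x] by auto
    then show ?thesis
      by simp
  qed
  then show ?thesis
    using permutes_in_image [OF assms] by (auto simp: matchings_def)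
qed

text \<open>Every element of \<open>B\<close> has squared convex distance at least \<open>t\<^sup>2\<close> to \<open>A\<close>, hence contributes at least
  \<open>exp (t\<^sup>2 / 16)\<close> to the sum in Talagrand's inequality.\<close>

theorem permutation_statistics_separation:
  fixes b :: "'a \<Rightarrow> 'a \<Rightarrow> real" and t :: real
  assumes "finite S" and b: "\<And>i j. i \<in> S \<Longrightarrow> j \<in> S \<Longrightarrow> 0 \<le> b i j" and t: "0 \<le> t"
    and A: "A \<subseteq> {\<pi>. \<pi> permutes S}" and B: "B \<subseteq> {\<pi>. \<pi> permutes S}"
    and gap: "\<And>\<pi> \<tau>. \<pi> \<in> B \<Longrightarrow> \<tau> \<in> A \<Longrightarrow>
      t * sqrt (\<Sum>i\<in>S. (b i (\<pi> i))\<^sup>2) < (\<Sum>i\<in>S. b i (\<pi> i)) - (\<Sum>i\<in>S. b i (\<tau> i))"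
  shows "real (card A) * real (card B) * exp (t\<^sup>2 / 16) \<le> (fact (card S))\<^sup>2"
proof (cases "A = {}")
  case False
  define G :: "('a \<Rightarrow> 'a) \<Rightarrow> ('a \<times> 'a) set" where "G = (\<lambda>\<pi>. (\<lambda>i. (i, \<pi> i)) ` S)"
  define \<beta> where "\<beta> = (\<lambda>e. b (fst e) (snd e))"
  let ?M = "matchings S S"
  have G: "G \<pi> \<in> ?M" if "\<pi> permutes S" for \<pi>
    using permutation_graph_matching [OF that] by (simp add: G_def)
  have sumG: "sum (\<lambda>e. f (fst e) (snd e)) (G \<pi>) = (\<Sum>i\<in>S. f i (\<pi> i))" for f :: "'a \<Rightarrow> 'a \<Rightarrow> real" and \<pi>
    unfolding G_def by (subst sum.reindex) (auto intro: inj_onI)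
  have inj: "inj_on G {\<pi>. \<pi> permutes S}"
  proof (rule inj_onI, rule ext)
    fix \<pi> \<pi>' i assume \<pi>: "\<pi> \<in> {\<pi>. \<pi> permutes S}" "\<pi>' \<in> {\<pi>. \<pi> permutes S}" and eq: "G \<pi> = G \<pi>'"
    show "\<pi> i = \<pi>' i"
    proof (cases "i \<in> S")
      case True
      then have "(i, \<pi> i) \<in> G \<pi>'"
        using eq by (auto simp: G_def)
      then show ?thesis
        by (auto simp: G_def)
    next
      case False
      then show ?thesis
        using \<pi> by (simp add: permutes_not_in)
    qed
  qed
  have finG: "finite (G \<pi>)" for \<pi>
    using \<open>finite S\<close> by (simp add: G_def)
  have finM: "finite ?M"
    using \<open>finite S\<close> by (simp add: finite_matchings)
  have "finite A"
    using A \<open>finite S\<close> finite_permutations finite_subset by blast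
  have "G ` A \<subseteq> ?M" "G ` B \<subseteq> ?M"
    using A B G by auto
  have "G ` A \<noteq> {}"
    using False by simp
  then obtain F where F: "\<And>\<sigma>. \<sigma> \<in> ?M \<Longrightarrow> hull_close (\<lambda>_. 1) (G ` A) \<sigma> (F \<sigma>)"
    and Fsum: "real (card (G ` A)) * (\<Sum>\<sigma>\<in>?M. exp (F \<sigma> / 16)) \<le> (real (card ?M))\<^sup>2"
    using talagrand_bound_unweighted [OF \<open>finite S\<close> \<open>finite S\<close>, unfolded talagrand_bound_def,
        rule_format, OF \<open>G ` A \<subseteq> ?M\<close>] by blast
  have nonneg: "0 \<le> \<beta> e" if "e \<in> G \<pi>" "\<pi> permutes S" for e \<pi>
    using G [OF that(2)] that(1) b by (auto simp: \<beta>_def matchings_def)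
  have far: "t\<^sup>2 \<le> F (G \<pi>)" if "\<pi> \<in> B" for \<pi>
  proof (rule hull_close_imp_gap [where \<beta> = \<beta>])
    show "hull_close (\<lambda>_. 1) (G ` A) (G \<pi>) (F (G \<pi>))"
      using that B G F by auto
    show "t * sqrt (\<Sum>e\<in>G \<pi>. (\<beta> e)\<^sup>2) < sum \<beta> (G \<pi>) - sum \<beta> \<tau>" if "\<tau> \<in> G ` A" for \<tau>
      using that gap [OF \<open>\<pi> \<in> B\<close>] sumG [of "\<lambda>i j. (b i j)\<^sup>2"] sumG [of b]
      by (auto simp: \<beta>_def)
    show "0 \<le> \<beta> e" if "\<tau> \<in> insert (G \<pi>) (G ` A)" "e \<in> \<tau>" for \<tau> e
    proof -
      obtain \<rho> where "\<tau> = G \<rho>" "\<rho> \<in> A \<union> B"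
        using \<open>\<tau> \<in> insert (G \<pi>) (G ` A)\<close> \<open>\<pi> \<in> B\<close> by blast
      then show ?thesis
        using nonneg [of e \<rho>] that A B by blast
    qed
  qed (use \<open>finite A\<close> finG t in auto)
  have "real (card A) * real (card B) * exp (t\<^sup>2 / 16) = real (card A) * (\<Sum>\<sigma>\<in>G ` B. exp (t\<^sup>2 / 16))"
    using card_image [OF inj_on_subset [OF inj B]] by simp
  also have "\<dots> \<le> real (card A) * (\<Sum>\<sigma>\<in>G ` B. exp (F \<sigma> / 16))"
    using far by (intro mult_left_mono sum_mono) auto
  also have "\<dots> \<le> real (card A) * (\<Sum>\<sigma>\<in>?M. exp (F \<sigma> / 16))"
    using finM \<open>G ` B \<subseteq> ?M\<close> by (intro mult_left_mono sum_mono2) auto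
  also have "\<dots> \<le> (real (card ?M))\<^sup>2"
    using Fsum card_image [OF inj_on_subset [OF inj A]] by simp
  also have "\<dots> \<le> (fact (card S))\<^sup>2"
  proof (rule power_mono)
    show "real (card ?M) \<le> fact (card S)"
      using card_matchings_le [OF \<open>finite S\<close> \<open>finite S\<close>] by (metis of_nat_fact of_nat_le_iff)
  qed simp
  finally show ?thesis .
qed simp

lemma uniform_random_permutation_measure:
  assumes "prob_space M" and \<sigma>: "uniform_random_permutation M n \<sigma>"
  shows "measure M {\<omega> \<in> space M. P (\<sigma> \<omega>)} = card {\<pi>. \<pi> permutes {1..n} \<and> P \<pi>} / fact n"
proof -
  let ?S = "{\<pi>. \<pi> permutes {1..n}}" and ?B = "{\<pi>. \<pi> permutes {1..n} \<and> P \<pi>}"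
  have meas: "\<sigma> \<in> measurable M (count_space ?S)"
    and distr: "distr M (count_space ?S) \<sigma> = uniform_count_measure ?S"
    using \<sigma> by (auto simp: uniform_random_permutation_def)
  have fin: "finite ?S"
    by (simp add: finite_permutations)
  have "\<sigma> \<omega> permutes {1..n}" if "\<omega> \<in> space M" for \<omega>
    using measurable_space [OF meas that] by simp
  then have "{\<omega> \<in> space M. P (\<sigma> \<omega>)} = \<sigma> -` ?B \<inter> space M"
    by auto
  then have "measure M {\<omega> \<in> space M. P (\<sigma> \<omega>)} = measure (distr M (count_space ?S) \<sigma>) ?B"
    by (subst measure_distr [OF meas]) auto
  also have "\<dots> = card ?B / card ?S"
    unfolding distr by (rule measure_uniform_count_measure [OF fin]) auto
  also have "card ?S = fact n"
    by (rule card_permutations) auto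
  finally show ?thesis by simp
qed

section \<open>Concentration around the median\<close>

lemma uniform_random_permutation_event:
  assumes "uniform_random_permutation M n \<sigma>"
  shows "{\<omega> \<in> space M. P (\<sigma> \<omega>)} \<in> sets M"
proof -
  have meas: "\<sigma> \<in> measurable M (count_space {\<pi>. \<pi> permutes {1..n}})"
    using assms by (simp add: uniform_random_permutation_def)
  have "\<sigma> -` {\<pi>. \<pi> permutes {1..n} \<and> P \<pi>} \<inter> space M \<in> sets M"
    by (rule measurable_sets [OF meas]) auto
  moreover have "{\<omega> \<in> space M. P (\<sigma> \<omega>)} = \<sigma> -` {\<pi>. \<pi> permutes {1..n} \<and> P \<pi>} \<inter> space M"
    using measurable_space [OF meas] by auto
  ultimately show ?thesis
    by simp
qed

lemma random_permutation_statistics_separation: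
  fixes b :: "nat \<Rightarrow> nat \<Rightarrow> real"
  assumes M: "prob_space M" "uniform_random_permutation M n \<sigma>"
    and b: "\<And>i j. i \<in> {1..n} \<Longrightarrow> j \<in> {1..n} \<Longrightarrow> 0 \<le> b i j" and "0 \<le> x"
    and gap: "\<And>\<pi> \<tau>. \<pi> permutes {1..n} \<Longrightarrow> Q \<pi> \<Longrightarrow> \<tau> permutes {1..n} \<Longrightarrow> P \<tau> \<Longrightarrow>
      sqrt x * sqrt (\<Sum>i=1..n. (b i (\<pi> i))\<^sup>2) < (\<Sum>i=1..n. b i (\<pi> i)) - (\<Sum>i=1..n. b i (\<tau> i))"
  shows "measure M {\<omega> \<in> space M. P (\<sigma> \<omega>)} * measure M {\<omega> \<in> space M. Q (\<sigma> \<omega>)} \<le> exp (- x / 16)"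
proof -
  let ?A = "{\<pi>. \<pi> permutes {1..n} \<and> P \<pi>}" and ?B = "{\<pi>. \<pi> permutes {1..n} \<and> Q \<pi>}"
  have "real (card ?A) * real (card ?B) * exp ((sqrt x)\<^sup>2 / 16) \<le> (fact (card {1..n}))\<^sup>2"
    by (rule permutation_statistics_separation [where b = b]) (use b gap \<open>0 \<le> x\<close> in auto)
  then have "real (card ?A) * real (card ?B) * exp (x / 16) \<le> fact n * fact n"
    using \<open>0 \<le> x\<close> by (simp add: power2_eq_square)
  then show ?thesis
    unfolding uniform_random_permutation_measure [OF M]
    by (simp add: exp_minus field_simps)
qed

theorem proposition2p1:
  fixes M :: "'w measure"
    and n :: nat
    and a :: "nat \<Rightarrow> nat \<Rightarrow> real"
    and \<sigma> :: "'w \<Rightarrow> nat \<Rightarrow> nat"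
    and Z :: "'w \<Rightarrow> real"
    and m v x :: real
  assumes "prob_space M"
    and "n \<ge> 1"
    and "\<And>i j. i \<in> {1..n} \<Longrightarrow> j \<in> {1..n} \<Longrightarrow> a i j \<ge> 0"
    and "uniform_random_permutation M n \<sigma>"
    and "Z = (\<lambda>\<omega>. \<Sum>i=1..n. a i (\<sigma> \<omega> i))"
    and "is_median M Z m"
    and "is_median M (\<lambda>\<omega>. \<Sum>i=1..n. (a i (\<sigma> \<omega> i))\<^sup>2) v"
    and "x > 0"
  shows "measure M {\<omega> \<in> space M.
           \<bar>Z \<omega> - m\<bar> > sqrt (v * x) + x * Max {a i j | i j. i \<in> {1..n} \<and> j \<in> {1..n}}}
         \<le> 8 * exp (- x / 16)"
proof -
  interpret prob_space M by fact
  define K where "K = Max {a i j | i j. i \<in> {1..n} \<and> j \<in> {1..n}}"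
  define W where "W = (\<lambda>\<pi>. \<Sum>i=1..n. a i (\<pi> i))"
  define V where "V = (\<lambda>\<pi>. \<Sum>i=1..n. (a i (\<pi> i))\<^sup>2)"
  define D where "D = sqrt x * (sqrt v + K * sqrt x)"
  define large_V where "large_V = (\<lambda>\<pi>. sqrt v + K * sqrt x < sqrt (V \<pi>))"
  define q where "q = exp (- x / 16)"
  define Pr where "Pr = (\<lambda>P. prob {\<omega> \<in> space M. P (\<sigma> \<omega>)})"
  have Pr_mono: "Pr P \<le> Pr P'" if "\<And>\<pi>. P \<pi> \<Longrightarrow> P' \<pi>" for P P'
    unfolding Pr_def using that
    by (intro finite_measure_mono uniform_random_permutation_event [OF assms(4)]) auto
  have Pr_disj: "Pr (\<lambda>\<pi>. P \<pi> \<or> P' \<pi>) \<le> Pr P + Pr P'" for P P'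
  proof -
    have "{\<omega> \<in> space M. P (\<sigma> \<omega>) \<or> P' (\<sigma> \<omega>)} = {\<omega> \<in> space M. P (\<sigma> \<omega>)} \<union> {\<omega> \<in> space M. P' (\<sigma> \<omega>)}"
      by auto
    then show ?thesis
      unfolding Pr_def
      by (simp add: measure_Un_le uniform_random_permutation_event [OF assms(4)])
  qed
  have sep: "Pr P * Pr Q \<le> q"
    if "\<And>i j. i \<in> {1..n} \<Longrightarrow> j \<in> {1..n} \<Longrightarrow> 0 \<le> b i j"
      and "\<And>\<pi> \<tau>. \<pi> permutes {1..n} \<Longrightarrow> Q \<pi> \<Longrightarrow> \<tau> permutes {1..n} \<Longrightarrow> P \<tau> \<Longrightarrow>
        sqrt x * sqrt (\<Sum>i=1..n. (b i (\<pi> i))\<^sup>2) < (\<Sum>i=1..n. b i (\<pi> i)) - (\<Sum>i=1..n. b i (\<tau> i))"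
    for P Q and b :: "nat \<Rightarrow> nat \<Rightarrow> real"
    unfolding Pr_def q_def
    by (rule random_permutation_statistics_separation [where b = b, OF assms(1,4)]) (use that assms(8) in auto)
  have halves: "1 / 2 \<le> Pr (\<lambda>\<pi>. m \<le> W \<pi>)" "1 / 2 \<le> Pr (\<lambda>\<pi>. W \<pi> \<le> m)" "1 / 2 \<le> Pr (\<lambda>\<pi>. V \<pi> \<le> v)"
    using assms(6,7) by (simp_all add: is_median_def assms(5) Pr_def W_def V_def)
  have "0 \<le> q"
    by (simp add: q_def)
  have finite_values: "finite {a i j | i j. i \<in> {1..n} \<and> j \<in> {1..n}}"
    by (rule finite_image_set2) auto
  have aK: "a i j \<le> K" if "i \<in> {1..n}" "j \<in> {1..n}" for i j
    unfolding K_def using finite_values that by (intro Max_ge) auto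
  have "0 \<le> K"
    using aK [of 1 1] assms(2) assms(3) [of 1 1] by auto
  have V_nonneg: "0 \<le> V \<pi>" for \<pi>
    by (simp add: V_def sum_nonneg)
  have "0 \<le> v"
  proof (rule ccontr)
    assume "\<not> 0 \<le> v"
    then have "\<not> V \<pi> \<le> v" for \<pi>
      using V_nonneg [of \<pi>] by linarith
    then show False
      using halves(3) by (simp add: Pr_def)
  qed
  have D: "D = sqrt (v * x) + x * K"
    using assms(8) by (simp add: D_def real_sqrt_mult algebra_simps)
  have V_le: "sqrt x * sqrt (V \<pi>) \<le> D" if "\<not> large_V \<pi>" for \<pi>
    using that assms(8) unfolding D_def large_V_def by (intro mult_left_mono) auto

  have large: "Pr large_V \<le> 2 * q"
  proof -
    have "Pr (\<lambda>\<pi>. V \<pi> \<le> v) * Pr large_V \<le> q"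
    proof (rule sep [of "\<lambda>i j. (a i j)\<^sup>2"])
      fix \<pi> \<tau> assume \<pi>: "\<pi> permutes {1..n}" "large_V \<pi>" and \<tau>: "V \<tau> \<le> v"
      \<comment> \<open>The normalising sum of fourth powers is at most \<open>K\<^sup>2 * V \<pi>\<close>, so it suffices that
        \<open>sqrt x * K * R < R\<^sup>2 - v\<close>, which holds because \<open>R * (R - K * sqrt x) > R * sqrt v \<ge> v\<close>.\<close>
      define R where "R = sqrt (V \<pi>)"
      have R: "sqrt v + K * sqrt x < R" "R\<^sup>2 = V \<pi>"
        using \<pi>(2) V_nonneg by (simp_all add: R_def large_V_def)
      have "(\<Sum>i=1..n. ((a i (\<pi> i))\<^sup>2)\<^sup>2) \<le> (\<Sum>i=1..n. K\<^sup>2 * (a i (\<pi> i))\<^sup>2)"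
      proof (rule sum_mono)
        fix i assume i: "i \<in> {1..n}"
        then have "\<pi> i \<in> {1..n}"
          using permutes_in_image [OF \<pi>(1)] by simp
        then have "(a i (\<pi> i))\<^sup>2 \<le> K\<^sup>2"
          using aK assms(3) i by (intro power_mono) auto
        then show "((a i (\<pi> i))\<^sup>2)\<^sup>2 \<le> K\<^sup>2 * (a i (\<pi> i))\<^sup>2"
          unfolding power2_eq_square [of "(a i (\<pi> i))\<^sup>2"] by (rule mult_right_mono) simp
      qed
      also have "\<dots> = K\<^sup>2 * V \<pi>"
        by (simp add: V_def sum_distrib_left)
      finally have "sqrt (\<Sum>i=1..n. ((a i (\<pi> i))\<^sup>2)\<^sup>2) \<le> sqrt (K\<^sup>2 * V \<pi>)"
        by (rule real_sqrt_le_mono)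
      also have "\<dots> = K * R"
        using \<open>0 \<le> K\<close> by (simp add: R_def real_sqrt_mult)
      finally have "sqrt x * sqrt (\<Sum>i=1..n. ((a i (\<pi> i))\<^sup>2)\<^sup>2) \<le> sqrt x * (K * R)"
        using assms(8) by (intro mult_left_mono) auto
      also have "\<dots> < R\<^sup>2 - v"
      proof -
        have "sqrt v \<le> R" "0 < R"
          using R(1) \<open>0 \<le> K\<close> \<open>0 \<le> v\<close> assms(8) by (smt (verit) mult_nonneg_nonneg real_sqrt_ge_zero)+
        have "v = sqrt v * sqrt v"
          using \<open>0 \<le> v\<close> by simp
        also have "\<dots> \<le> sqrt v * R"
          using \<open>sqrt v \<le> R\<close> \<open>0 \<le> v\<close> by (intro mult_left_mono) auto
        also have "\<dots> < (R - K * sqrt x) * R"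
          using R(1) \<open>0 < R\<close> by (intro mult_strict_right_mono) auto
        finally show ?thesis
          by (simp add: power2_eq_square algebra_simps)
      qed
      also have "\<dots> \<le> V \<pi> - V \<tau>"
        using \<tau> R(2) by simp
      finally show "sqrt x * sqrt (\<Sum>i=1..n. ((a i (\<pi> i))\<^sup>2)\<^sup>2) < (\<Sum>i=1..n. (a i (\<pi> i))\<^sup>2) - (\<Sum>i=1..n. (a i (\<tau> i))\<^sup>2)"
        by (simp add: V_def)
    qed simp
    moreover have "1 / 2 * Pr large_V \<le> Pr (\<lambda>\<pi>. V \<pi> \<le> v) * Pr large_V"
      using halves(3) by (intro mult_right_mono) (auto simp: Pr_def)
    ultimately show ?thesis
      by simp
  qed

  have upper: "Pr (\<lambda>\<pi>. m + D < W \<pi>) \<le> 4 * q"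
  proof -
    have "Pr (\<lambda>\<pi>. W \<pi> \<le> m) * Pr (\<lambda>\<pi>. m + sqrt x * sqrt (V \<pi>) < W \<pi>) \<le> q"
      by (rule sep [of a]) (use assms(3) in \<open>auto simp: W_def V_def\<close>)
    moreover have "1 / 2 * Pr (\<lambda>\<pi>. m + sqrt x * sqrt (V \<pi>) < W \<pi>) \<le>
        Pr (\<lambda>\<pi>. W \<pi> \<le> m) * Pr (\<lambda>\<pi>. m + sqrt x * sqrt (V \<pi>) < W \<pi>)"
      using halves(2) by (intro mult_right_mono) (auto simp: Pr_def)
    moreover have "Pr (\<lambda>\<pi>. m + D < W \<pi>) \<le> Pr (\<lambda>\<pi>. m + sqrt x * sqrt (V \<pi>) < W \<pi> \<or> large_V \<pi>)"
      using V_le by (intro Pr_mono) force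
    ultimately show ?thesis
      using Pr_disj [of "\<lambda>\<pi>. m + sqrt x * sqrt (V \<pi>) < W \<pi>" large_V] large by linarith
  qed

  have lower: "Pr (\<lambda>\<pi>. W \<pi> < m - D) \<le> 4 * q" if "q < 1 / 8"
  proof -
    have "Pr (\<lambda>\<pi>. W \<pi> < m - D) * Pr (\<lambda>\<pi>. m \<le> W \<pi> \<and> \<not> large_V \<pi>) \<le> q"
    proof (rule sep [of a])
      fix \<pi> \<tau> assume "m \<le> W \<pi> \<and> \<not> large_V \<pi>" "W \<tau> < m - D"
      then have "sqrt x * sqrt (V \<pi>) < W \<pi> - W \<tau>"
        using V_le [of \<pi>] by linarith
      then show "sqrt x * sqrt (\<Sum>i=1..n. (a i (\<pi> i))\<^sup>2) < (\<Sum>i=1..n. a i (\<pi> i)) - (\<Sum>i=1..n. a i (\<tau> i))"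
        by (simp add: W_def V_def)
    qed (use assms(3) in auto)
    moreover have "1 / 4 \<le> Pr (\<lambda>\<pi>. m \<le> W \<pi> \<and> \<not> large_V \<pi>)"
    proof -
      have "Pr (\<lambda>\<pi>. m \<le> W \<pi>) \<le> Pr (\<lambda>\<pi>. (m \<le> W \<pi> \<and> \<not> large_V \<pi>) \<or> large_V \<pi>)"
        by (intro Pr_mono) auto
      then show ?thesis
        using Pr_disj [of "\<lambda>\<pi>. m \<le> W \<pi> \<and> \<not> large_V \<pi>" large_V] large halves(1) that by linarith
    qed
    then have "Pr (\<lambda>\<pi>. W \<pi> < m - D) * (1 / 4) \<le> Pr (\<lambda>\<pi>. W \<pi> < m - D) * Pr (\<lambda>\<pi>. m \<le> W \<pi> \<and> \<not> large_V \<pi>)"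
      by (intro mult_left_mono) (auto simp: Pr_def)
    ultimately show ?thesis
      by simp
  qed

  have "Pr (\<lambda>\<pi>. D < \<bar>W \<pi> - m\<bar>) \<le> 8 * q"
  proof (cases "q < 1 / 8")
    case True
    have "Pr (\<lambda>\<pi>. D < \<bar>W \<pi> - m\<bar>) \<le> Pr (\<lambda>\<pi>. m + D < W \<pi> \<or> W \<pi> < m - D)"
      by (intro Pr_mono) auto
    then show ?thesis
      using Pr_disj [of "\<lambda>\<pi>. m + D < W \<pi>" "\<lambda>\<pi>. W \<pi> < m - D"] upper lower [OF True] by linarith
  next
    case False
    moreover have "Pr (\<lambda>\<pi>. D < \<bar>W \<pi> - m\<bar>) \<le> 1"
      by (simp add: Pr_def)
    ultimately show ?thesis
      by linarith
  qed
  then show ?thesis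
    by (simp add: Pr_def q_def W_def D K_def assms(5))
qed

end
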